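(* Let $m$ be a locally summable weight on a simplicial complex $\Sigma$. If $Q^H_D=Q^H_N$, then (one has $\Delta^\circ_D=\Delta^\circ_N$ for all $\circ\in\{+,-,H\}$ and), denoting $\Delta^\circ=\Delta^\circ_D=\Delta^\circ_N$, $$\sigma(\Delta^+)\setminus\{0\}=\sigma(\Delta^H)\setminus\{0\}=\sigma(\Delta^-)\setminus\{0\},$$ where $\sigma(\cdot)$ denotes the spectrum.
   Context: Simplicial complex: $V$ is a countable set and $\hat\Sigma$ is a collection of finite subsets of $V$ closed under taking subsets. $\dim\tau=|\tau|-1$, $\hat\Sigma_k=\{\tau\in\hat\Sigma:\dim\tau=k\}$. A weight is a function $m:\hat\Sigma\to(0,\infty)$. Put $\Sigma=\hat\Sigma$ if $\sum_{v\in\hat\Sigma_0}m(v)<\infty$, and $\Sigma=\hat\Sigma\setminus\{\varnothing\}$ otherwise. For $\tau,\sigma\in\Sigma$, $\tau\prec\sigma$ (equivalently $\sigma\succ\tau$) means $\tau\subset\sigma$ and $|\sigma\setminus\tau|=1$. All sums are over elements of $\Sigma$. The weight is locally summable if $\sum_{\sigma\succ\tau}m(\sigma)<\infty$ for all $\tau\in\Sigma$. Functions: $F=\mathbb{R}^{\Sigma}$; $F^c$ is the subspace of finitely supported functions; $F^1=\{\omega\in F:\sum_{\sigma\succ\tau}m(\sigma)|\omega(\sigma)|<\infty\text{ for all }\tau\in\Sigma\}$. Coboundary operator: a linear map $\delta:F\to F$ with $\delta\delta=0$ such that $\theta(\tau,\sigma):=\delta 1_\tau(\sigma)\in\{-1,0,1\}$,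 $\theta(\tau,\sigma)\neq0$ iff $\tau\prec\sigma$, and $\delta\omega(\sigma)=\sum_{\tau\prec\sigma}\omega(\tau)\theta(\tau,\sigma)$. Boundary operator: $\partial:F^1\to F$, $\partial\omega(\rho)=\frac1{m(\rho)}\sum_{\tau\succ\rho}m(\tau)\omega(\tau)\theta(\rho,\tau)$. Forms and Laplacians: $\|\omega\|^2=\sum_\Sigma m\omega^2$, $\ell^2=\ell^2(\Sigma,m)=\{\omega\in F:\|\omega\|<\infty\}$. Put $\mathcal Q^+(\omega)=\|\delta\omega\|^2$ for $\omega\in F$, and $\mathcal Q^-(\omega)=\|\partial\omega\|^2$, $\mathcal Q^H(\omega)=\|\delta\omega+\partial\omega\|^2$ for $\omega\in F^1$. For $\circ\in\{+,-,H\}$, $Q^\circ_N$ is the restriction of $\mathcal Q^\circ$ to $D(Q^\circ_N)=\{\omega\in\ell^2:\mathcal Q^\circ(\omega)<\infty\}$ (under local summability $\ell^2\subseteq F^1$), and $Q^\circ_D$ its restriction to the closure of $F^c$ in $D(Q_N^\circ)$ with respect to $(\mathcal Q^\circ(\cdot)+\|\cdot\|^2)^{1/2}$. Both are closed positive forms on $\ell^2$; $\Delta^\circ_N$ and $\Delta^\circ_D$ are the associated positive self-adjoint operators on $\ell^2$. *)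

theory Defs
  imports "HOL-Analysis.Analysis"
begin

section \<open>Weighted simplicial complexes\<close>

definition abstract_simplicial_complex :: "'v set \<Rightarrow> 'v set set \<Rightarrow> bool" where
  "abstract_simplicial_complex V K \<longleftrightarrow>
     countable V \<and> (\<forall>\<tau>\<in>K. finite \<tau> \<and> \<tau> \<subseteq> V) \<and> (\<forall>\<sigma>\<in>K. \<forall>\<tau>. \<tau> \<subseteq> \<sigma> \<longrightarrow> \<tau> \<in> K)"

text \<open>Integer valued, so that the empty simplex has dimension \<open>-1\<close>.\<close>

definition sdim :: "'v set \<Rightarrow> int" where
  "sdim \<tau> = int (card \<tau>) - 1"

definition simplices :: "'v set set \<Rightarrow> int \<Rightarrow> 'v set set" where
  "simplices K k = {\<tau>\<in>K. sdim \<tau> = k}"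

definition simplex_weight :: "'v set set \<Rightarrow> ('v set \<Rightarrow> real) \<Rightarrow> bool" where
  "simplex_weight K m \<longleftrightarrow> (\<forall>\<tau>\<in>K. 0 < m \<tau>)"

text \<open>The complex \<open>\<Sigma>\<close> obtained from \<open>\<Sigma>\<close>-hat (here \<open>K\<close>). In all later definitions the
  parameter \<open>S\<close> stands for \<open>\<Sigma>\<close>.\<close>

definition weighted_complex :: "'v set set \<Rightarrow> ('v set \<Rightarrow> real) \<Rightarrow> 'v set set" where
  "weighted_complex K m = (if m summable_on simplices K 0 then K else K - {{}})"

definition face_of_codim1 :: "'v set set \<Rightarrow> 'v set \<Rightarrow> 'v set \<Rightarrow> bool" where
  "face_of_codim1 S \<tau> \<sigma> \<longleftrightarrow> \<tau> \<in> S \<and> \<sigma> \<in> S \<and> \<tau> \<subset> \<sigma> \<and> card (\<sigma> - \<tau>) = 1"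

definition locally_summable :: "'v set set \<Rightarrow> ('v set \<Rightarrow> real) \<Rightarrow> bool" where
  "locally_summable S m \<longleftrightarrow> (\<forall>\<tau>\<in>S. m summable_on {\<sigma>. face_of_codim1 S \<tau> \<sigma>})"


section \<open>Function spaces, coboundary and boundary operator\<close>

text \<open>A function on \<open>\<Sigma>\<close> is encoded as a function on all sets of vertices which
  vanishes outside \<open>\<Sigma>\<close>.\<close>

type_synonym 'v cochain = "'v set \<Rightarrow> real"

definition cochains :: "'v set set \<Rightarrow> 'v cochain set" where
  "cochains S = {\<omega>. \<forall>\<tau>. \<tau> \<notin> S \<longrightarrow> \<omega> \<tau> = 0}"

definition cochains_fin :: "'v set set \<Rightarrow> 'v cochain set" where
  "cochains_fin S = {\<omega>\<in>cochains S. finite {\<tau>. \<omega> \<tau> \<noteq> 0}}"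

definition cochains1 :: "'v set set \<Rightarrow> ('v set \<Rightarrow> real) \<Rightarrow> 'v cochain set" where
  "cochains1 S m = {\<omega>\<in>cochains S.
     \<forall>\<tau>\<in>S. (\<lambda>\<sigma>. m \<sigma> * \<bar>\<omega> \<sigma>\<bar>) summable_on {\<sigma>. face_of_codim1 S \<tau> \<sigma>}}"

definition incidence :: "('v cochain \<Rightarrow> 'v cochain) \<Rightarrow> 'v set \<Rightarrow> 'v set \<Rightarrow> real" where
  "incidence \<delta> \<tau> \<sigma> = \<delta> (indicat_real {\<tau>}) \<sigma>"

text \<open>The last sum below is finite, since \<open>\<sigma>\<close> is a finite set.\<close>

definition coboundary_operator :: "'v set set \<Rightarrow> ('v cochain \<Rightarrow> 'v cochain) \<Rightarrow> bool" where
  "coboundary_operator S \<delta> \<longleftrightarrow>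
     (\<forall>\<omega>\<in>cochains S. \<delta> \<omega> \<in> cochains S) \<and>
     (\<forall>\<omega>\<in>cochains S. \<forall>\<eta>\<in>cochains S. \<delta> (\<lambda>\<tau>. \<omega> \<tau> + \<eta> \<tau>) = (\<lambda>\<sigma>. \<delta> \<omega> \<sigma> + \<delta> \<eta> \<sigma>)) \<and>
     (\<forall>c. \<forall>\<omega>\<in>cochains S. \<delta> (\<lambda>\<tau>. c * \<omega> \<tau>) = (\<lambda>\<sigma>. c * \<delta> \<omega> \<sigma>)) \<and>
     (\<forall>\<omega>\<in>cochains S. \<delta> (\<delta> \<omega>) = (\<lambda>\<sigma>. 0)) \<and>
     (\<forall>\<tau>\<in>S. \<forall>\<sigma>\<in>S. incidence \<delta> \<tau> \<sigma> \<in> {-1, 0, 1} \<and>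
                  (incidence \<delta> \<tau> \<sigma> \<noteq> 0 \<longleftrightarrow> face_of_codim1 S \<tau> \<sigma>)) \<and>
     (\<forall>\<omega>\<in>cochains S. \<forall>\<sigma>\<in>S.
        \<delta> \<omega> \<sigma> = (\<Sum>\<tau> | face_of_codim1 S \<tau> \<sigma>. \<omega> \<tau> * incidence \<delta> \<tau> \<sigma>))"

text \<open>Only used for \<open>\<omega>\<close> in \<open>cochains1 S m\<close>, where the sum converges absolutely.\<close>

definition boundary ::
  "'v set set \<Rightarrow> ('v set \<Rightarrow> real) \<Rightarrow> ('v cochain \<Rightarrow> 'v cochain) \<Rightarrow> 'v cochain \<Rightarrow> 'v cochain" where
  "boundary S m \<delta> \<omega> \<rho> =
     (if \<rho> \<in> S
      then 1 / m \<rho> * (\<Sum>\<^sub>\<infinity>\<tau> | face_of_codim1 S \<rho> \<tau>. m \<tau> * \<omega> \<tau> * incidence \<delta> \<rho> \<tau>)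
      else 0)"


section \<open>The real Hilbert space \<open>\<ell>\<^sup>2(\<Sigma>,m)\<close>\<close>

text \<open>The squared norm is extended real valued, so that it makes sense (and may be infinite)
  for every function.\<close>

definition nsq :: "'v set set \<Rightarrow> ('v set \<Rightarrow> real) \<Rightarrow> 'v cochain \<Rightarrow> ennreal" where
  "nsq S m \<omega> = (\<Sum>\<^sub>\<infinity>\<tau>\<in>S. ennreal (m \<tau> * (\<omega> \<tau>)\<^sup>2))"

definition l2 :: "'v set set \<Rightarrow> ('v set \<Rightarrow> real) \<Rightarrow> 'v cochain set" where
  "l2 S m = {\<omega>\<in>cochains S. nsq S m \<omega> < \<infinity>}"

definition l2_norm :: "'v set set \<Rightarrow> ('v set \<Rightarrow> real) \<Rightarrow> 'v cochain \<Rightarrow> real" where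
  "l2_norm S m \<omega> = sqrt (enn2real (nsq S m \<omega>))"

definition l2_inner :: "'v set set \<Rightarrow> ('v set \<Rightarrow> real) \<Rightarrow> 'v cochain \<Rightarrow> 'v cochain \<Rightarrow> real" where
  "l2_inner S m \<omega> \<eta> = (\<Sum>\<^sub>\<infinity>\<tau>\<in>S. m \<tau> * \<omega> \<tau> * \<eta> \<tau>)"


section \<open>Forms and operators\<close>

text \<open>Quadratic forms and unbounded operators on \<open>\<ell>\<^sup>2\<close> are partial functions; their domain
  is \<open>dom\<close>. Equality of forms or operators thus includes equality of domains.\<close>

type_synonym 'v qform = "'v cochain \<rightharpoonup> real"
type_synonym 'v l2_op = "'v cochain \<rightharpoonup> 'v cochain"

definition form_norm :: "'v set set \<Rightarrow> ('v set \<Rightarrow> real) \<Rightarrow> 'v qform \<Rightarrow> 'v cochain \<Rightarrow> real" where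
  "form_norm S m q \<omega> = sqrt (the (q \<omega>) + (l2_norm S m \<omega>)\<^sup>2)"

definition form_closure ::
  "'v set set \<Rightarrow> ('v set \<Rightarrow> real) \<Rightarrow> 'v qform \<Rightarrow> 'v cochain set \<Rightarrow> 'v cochain set" where
  "form_closure S m q A =
     {\<omega>\<in>dom q. \<forall>\<epsilon>>0. \<exists>\<phi>\<in>A \<inter> dom q. form_norm S m q (\<lambda>\<tau>. \<omega> \<tau> - \<phi> \<tau>) < \<epsilon>}"

definition polar_form :: "'v qform \<Rightarrow> 'v cochain \<Rightarrow> 'v cochain \<Rightarrow> real" where
  "polar_form q \<omega> \<phi> =
     (the (q (\<lambda>\<tau>. \<omega> \<tau> + \<phi> \<tau>)) - the (q (\<lambda>\<tau>. \<omega> \<tau> - \<phi> \<tau>))) / 4"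

text \<open>The operator \<open>A\<close> associated with a densely defined closed positive form \<open>q\<close> by the
  representation theorem: \<open>\<omega>\<close> is in the domain of \<open>A\<close> iff \<open>\<omega>\<close> is in the domain of \<open>q\<close> and there
  is \<open>\<eta>\<close> in \<open>\<ell>\<^sup>2\<close> such that \<open>q(\<omega>,\<phi>) = \<langle>\<eta>,\<phi>\<rangle>\<close> for all \<open>\<phi>\<close> in the domain of \<open>q\<close>;
  this \<open>\<eta>\<close>, unique by density, is \<open>A \<omega>\<close>.\<close>

definition represents ::
  "'v set set \<Rightarrow> ('v set \<Rightarrow> real) \<Rightarrow> 'v qform \<Rightarrow> 'v cochain \<Rightarrow> 'v cochain \<Rightarrow> bool" where
  "represents S m q \<omega> \<eta> \<longleftrightarrow>
     \<eta> \<in> l2 S m \<and> (\<forall>\<phi>\<in>dom q. polar_form q \<omega> \<phi> = l2_inner S m \<eta> \<phi>)"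

definition form_operator ::
  "'v set set \<Rightarrow> ('v set \<Rightarrow> real) \<Rightarrow> 'v qform \<Rightarrow> 'v l2_op" where
  "form_operator S m q =
     (\<lambda>\<omega>. if \<omega> \<in> dom q \<and> (\<exists>\<eta>. represents S m q \<omega> \<eta>)
          then Some (THE \<eta>. represents S m q \<omega> \<eta>) else None)"

definition shifted :: "'v l2_op \<Rightarrow> real \<Rightarrow> 'v cochain \<Rightarrow> 'v cochain" where
  "shifted A \<mu> \<omega> = (\<lambda>\<tau>. the (A \<omega>) \<tau> - \<mu> * \<omega> \<tau>)"

text \<open>The Hilbert space is real, so the spectrum is a set of real numbers; \<open>\<mu>\<close> belongs to
  the resolvent set iff \<open>A - \<mu>\<close> maps the domain of \<open>A\<close> bijectively onto \<open>\<ell>\<^sup>2\<close> with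
  bounded inverse.\<close>

definition resolvent_set ::
  "'v set set \<Rightarrow> ('v set \<Rightarrow> real) \<Rightarrow> 'v l2_op \<Rightarrow> real set" where
  "resolvent_set S m A =
     {\<mu>. bij_betw (shifted A \<mu>) (dom A) (l2 S m) \<and>
         (\<exists>C. \<forall>\<omega>\<in>dom A. l2_norm S m \<omega> \<le> C * l2_norm S m (shifted A \<mu> \<omega>))}"

definition op_spectrum ::
  "'v set set \<Rightarrow> ('v set \<Rightarrow> real) \<Rightarrow> 'v l2_op \<Rightarrow> real set" where
  "op_spectrum S m A = - resolvent_set S m A"


section \<open>The forms \<open>Q\<close> and the Laplacians\<close>

text \<open>The three superscripts \<open>+\<close>, \<open>-\<close>, \<open>H\<close>.\<close>

datatype kind = Up | Down | Hodge

fun energy_domain :: "'v set set \<Rightarrow> ('v set \<Rightarrow> real) \<Rightarrow> kind \<Rightarrow> 'v cochain set" where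
  "energy_domain S m Up = cochains S"
| "energy_domain S m Down = cochains1 S m"
| "energy_domain S m Hodge = cochains1 S m"

fun energy ::
  "'v set set \<Rightarrow> ('v set \<Rightarrow> real) \<Rightarrow> ('v cochain \<Rightarrow> 'v cochain) \<Rightarrow> kind \<Rightarrow> 'v cochain \<Rightarrow> ennreal" where
  "energy S m \<delta> Up \<omega> = nsq S m (\<delta> \<omega>)"
| "energy S m \<delta> Down \<omega> = nsq S m (boundary S m \<delta> \<omega>)"
| "energy S m \<delta> Hodge \<omega> = nsq S m (\<lambda>\<tau>. \<delta> \<omega> \<tau> + boundary S m \<delta> \<omega> \<tau>)"

definition form_N ::
  "'v set set \<Rightarrow> ('v set \<Rightarrow> real) \<Rightarrow> ('v cochain \<Rightarrow> 'v cochain) \<Rightarrow> kind \<Rightarrow> 'v qform" where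
  "form_N S m \<delta> k =
     (\<lambda>\<omega>. if \<omega> \<in> l2 S m \<inter> energy_domain S m k \<and> energy S m \<delta> k \<omega> < \<infinity>
          then Some (enn2real (energy S m \<delta> k \<omega>)) else None)"

definition form_D ::
  "'v set set \<Rightarrow> ('v set \<Rightarrow> real) \<Rightarrow> ('v cochain \<Rightarrow> 'v cochain) \<Rightarrow> kind \<Rightarrow> 'v qform" where
  "form_D S m \<delta> k =
     form_N S m \<delta> k |` form_closure S m (form_N S m \<delta> k) (cochains_fin S)"

definition laplacian_N ::
  "'v set set \<Rightarrow> ('v set \<Rightarrow> real) \<Rightarrow> ('v cochain \<Rightarrow> 'v cochain) \<Rightarrow> kind \<Rightarrow> 'v l2_op" where
  "laplacian_N S m \<delta> k = form_operator S m (form_N S m \<delta> k)"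

definition laplacian_D ::
  "'v set set \<Rightarrow> ('v set \<Rightarrow> real) \<Rightarrow> ('v cochain \<Rightarrow> 'v cochain) \<Rightarrow> kind \<Rightarrow> 'v l2_op" where
  "laplacian_D S m \<delta> k = form_operator S m (form_D S m \<delta> k)"

end

theory Submission
  imports Defs
begin

text \<open>
  Let \<open>T\<close> be \<open>\<delta> + \<partial>\<close> with maximal domain. The hypothesis says that finitely supported cochains form
  a core of \<open>T\<close>, so \<open>T\<close> is symmetric; since \<open>\<parallel>T\<phi>\<parallel>\<^sup>2 = \<parallel>\<delta>\<phi>\<parallel>\<^sup>2 + \<parallel>\<partial>\<phi>\<parallel>\<^sup>2\<close> on this core, every \<open>\<omega>\<close> in the
  domain of \<open>T\<close> has \<open>\<delta>\<omega>\<close> and \<open>\<partial>\<omega>\<close> in \<open>\<ell>\<^sup>2\<close>. If \<open>\<omega>\<close> lies in the maximal domain of \<open>\<delta>\<close> and is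
  orthogonal to the core in the graph norm, then \<open>\<partial>\<delta>\<omega> = -\<omega>\<close>, hence \<open>T\<omega> = \<delta>\<omega>\<close>, \<open>T\<delta>\<omega> = -\<omega>\<close>, and
  symmetry of \<open>T\<close> gives \<open>\<omega> = 0\<close>; similarly for \<open>\<partial>\<close>. So the maximal operators \<open>\<delta>\<close> and \<open>\<partial>\<close> are
  adjoint to each other, and the Laplacians are \<open>\<partial>\<delta>\<close>, \<open>\<delta>\<partial>\<close> and \<open>T\<^sup>2\<close>. Away from \<open>0\<close>, the spectra of
  \<open>\<partial>\<delta>\<close> and \<open>\<delta>\<partial>\<close> agree as for any closed operator and its adjoint, and \<open>T\<^sup>2\<close> is \<open>\<delta>\<partial>\<close> on \<open>ker \<delta>\<close>
  and \<open>\<partial>\<delta>\<close> on its orthogonal complement.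
\<close>

section \<open>Orthogonal projection\<close>

text \<open>A minimizing sequence for the squared distance from \<open>x\<close> to \<open>M\<close>
  is Cauchy by the parallelogram law. Its limit attains the minimum, and minimality along every line
  through \<open>p\<close> in \<open>M\<close> forces orthogonality.\<close>

lemma orthogonal_projection_exists:
  fixes M :: "'h::{real_inner,complete_space} set"
  assumes "closed M" "subspace M"
  obtains p where "p \<in> M" "\<And>v. v \<in> M \<Longrightarrow> inner (x - p) v = 0"
proof -
  define r where "r = (INF v\<in>M. (norm (x - v))\<^sup>2)"
  have bdd: "bdd_below ((\<lambda>v. (norm (x - v))\<^sup>2) ` M)"
    by (rule bdd_belowI2[of _ 0]) simp
  have ne: "M \<noteq> {}" using assms(2) subspace_0 by auto
  have r_le: "r \<le> (norm (x - v))\<^sup>2" if "v \<in> M" for v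
    unfolding r_def using bdd that by (rule cINF_lower)
  have "\<exists>v\<in>M. (norm (x - v))\<^sup>2 < r + 1 / real (Suc n)" for n
    using cINF_less_iff[OF ne bdd, of "r + 1 / real (Suc n)"] by (simp add: r_def)
  then obtain X where X: "\<And>n. X n \<in> M" "\<And>n. (norm (x - X n))\<^sup>2 < r + 1 / real (Suc n)"
    by metis
  \<comment> \<open>Parallelogram law for \<open>x - u\<close> and \<open>x - v\<close>; the
    midpoint of \<open>u\<close> and \<open>v\<close> lies in \<open>M\<close>, so its squared
    distance to \<open>x\<close> is at least \<open>r\<close>.\<close>
  have par: "(norm (u - v))\<^sup>2 \<le> 2 * ((norm (x - u))\<^sup>2 - r) + 2 * ((norm (x - v))\<^sup>2 - r)"
    if "u \<in> M" "v \<in> M" for u v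
  proof -
    have "(1/2) *\<^sub>R (u + v) \<in> M"
      using assms(2) that by (simp add: subspace_add subspace_scale)
    then have "r \<le> (norm (x - (1/2) *\<^sub>R (u + v)))\<^sup>2" by (rule r_le)
    moreover have "(norm (u - v))\<^sup>2 + 4 * (norm (x - (1/2) *\<^sub>R (u + v)))\<^sup>2
        = 2 * (norm (x - u))\<^sup>2 + 2 * (norm (x - v))\<^sup>2"
      by (simp add: power2_norm_eq_inner inner_diff_left inner_diff_right inner_add_left
          inner_add_right inner_commute algebra_simps)
    ultimately show ?thesis by (simp add: algebra_simps)
  qed
  have "Cauchy X"
  proof (rule metric_CauchyI)
    fix e :: real assume "e > 0"
    then obtain N where N: "4 / e\<^sup>2 < real N" using reals_Archimedean2 by blast
    show "\<exists>N. \<forall>m\<ge>N. \<forall>n\<ge>N. dist (X m) (X n) < e"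
    proof (intro exI allI impI)
      fix m n assume mn: "m \<ge> N" "n \<ge> N"
      have small: "1 / real (Suc k) < e\<^sup>2 / 4" if "k \<ge> N" for k
      proof -
        have "4 / e\<^sup>2 < real (Suc k)" using N that by linarith
        then show ?thesis using \<open>e > 0\<close> by (simp add: field_simps)
      qed
      have "(norm (x - X m))\<^sup>2 - r < e\<^sup>2 / 4" "(norm (x - X n))\<^sup>2 - r < e\<^sup>2 / 4"
        using X(2)[of m] X(2)[of n] small[OF mn(1)] small[OF mn(2)] by simp_all
      then have "(norm (X m - X n))\<^sup>2 < e\<^sup>2"
        using par[OF X(1)[of m] X(1)[of n]] by simp
      then show "dist (X m) (X n) < e"
        using \<open>e > 0\<close> by (simp add: dist_norm power2_less_imp_less)
    qed
  qed
  then obtain p where p: "X \<longlonglongrightarrow> p" using Cauchy_convergent_iff convergent_def by blast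
  have pM: "p \<in> M" using assms(1) X(1) p closed_sequentially by blast
  have "(\<lambda>n. r + 1 / real (Suc n)) \<longlonglongrightarrow> r + 0"
    by (intro tendsto_intros LIMSEQ_Suc lim_1_over_n[where 'a=real])
  moreover have "(\<lambda>n. (norm (x - X n))\<^sup>2) \<longlonglongrightarrow> (norm (x - p))\<^sup>2"
    by (intro tendsto_intros p)
  ultimately have p_le: "(norm (x - p))\<^sup>2 \<le> r"
    using LIMSEQ_le[of "\<lambda>n. (norm (x - X n))\<^sup>2"] X(2) less_imp_le by (metis (no_types, lifting) add.right_neutral)
  have "inner (x - p) v = 0" if v: "v \<in> M" for v
  proof (cases "v = 0")
    case False
    \<comment> \<open>This \<open>t\<close> minimizes the distance from \<open>x\<close> to the
      points \<open>p + t *\<^sub>R v\<close>.\<close>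
    define t where "t = inner (x - p) v / inner v v"
    have vv: "inner v v > 0" using False by simp
    have "p + t *\<^sub>R v \<in> M"
      using assms(2) pM v by (simp add: subspace_add subspace_scale)
    then have "(norm (x - p))\<^sup>2 \<le> (norm (x - (p + t *\<^sub>R v)))\<^sup>2"
      using r_le p_le order_trans by blast
    also have "\<dots> = (norm (x - p - t *\<^sub>R v))\<^sup>2" by (simp add: diff_diff_eq)
    also have "\<dots> = (norm (x - p))\<^sup>2 - 2 * t * inner (x - p) v + t\<^sup>2 * inner v v"
      unfolding power2_norm_eq_inner inner_diff_left[of "x - p"] inner_diff_right[of _ "x - p"]
      using inner_commute[of v "x - p"] by (simp add: power2_eq_square)
    also have "\<dots> = (norm (x - p))\<^sup>2 - (inner (x - p) v)\<^sup>2 / inner v v"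
      using vv by (simp add: t_def power2_eq_square field_simps)
    finally have "(inner (x - p) v)\<^sup>2 / inner v v \<le> 0" by simp
    then have "(inner (x - p) v)\<^sup>2 \<le> 0" using vv by (simp add: divide_le_0_iff)
    then show ?thesis by simp
  qed simp
  then show thesis using that pM by blast
qed

lemma subspace_closure:
  fixes M :: "'h::real_normed_vector set"
  assumes "subspace M"
  shows "subspace (closure M)"
  unfolding subspace_def
proof (intro conjI ballI allI)
  show "0 \<in> closure M" using subspace_0[OF assms] closure_subset by blast
  fix x y and c :: real assume x: "x \<in> closure M" and y: "y \<in> closure M"
  obtain X where X: "\<And>n. X n \<in> M" "X \<longlonglongrightarrow> x" using x closure_sequential by blast
  obtain Y where Y: "\<And>n. Y n \<in> M" "Y \<longlonglongrightarrow> y" using y closure_sequential by blast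
  have "\<And>n. X n + Y n \<in> M" using subspace_add[OF assms] X(1) Y(1) by blast
  then show "x + y \<in> closure M"
    unfolding closure_sequential using tendsto_add[OF X(2) Y(2)]
    by (intro exI[of _ "\<lambda>n. X n + Y n"]) blast
  have "\<And>n. c *\<^sub>R X n \<in> M" using subspace_scale[OF assms] X(1) by blast
  then show "c *\<^sub>R x \<in> closure M"
    unfolding closure_sequential using tendsto_scaleR[OF tendsto_const X(2)]
    by (intro exI[of _ "\<lambda>n. c *\<^sub>R X n"]) blast
qed

section \<open>Adjoint relations\<close>

text \<open>Unbounded operators in a closed subspace \<open>H\<close> are represented by their graphs. Composition of
  relations reads from left to right, so \<open>D O E\<close> is the graph of the operator \<open>ED\<close>.\<close>

definition adjoint_rel :: "'h::real_inner set \<Rightarrow> ('h \<times> 'h) set \<Rightarrow> ('h \<times> 'h) set" where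
  "adjoint_rel H R = {(x, y). x \<in> H \<and> y \<in> H \<and> (\<forall>(u, v)\<in>R. inner y u = inner x v)}"

lemma adjoint_relD:
  "(x, y) \<in> adjoint_rel H R \<Longrightarrow> (u, v) \<in> R \<Longrightarrow> inner y u = inner x v"
  by (auto simp: adjoint_rel_def)

lemma adjoint_rel_subset: "adjoint_rel H R \<subseteq> H \<times> H"
  by (auto simp: adjoint_rel_def)

lemma subspace_adjoint_rel: "subspace H \<Longrightarrow> subspace (adjoint_rel H R)"
  unfolding subspace_def adjoint_rel_def
  by (auto simp: zero_prod_def inner_add_left split_beta)

lemma closed_adjoint_rel:
  assumes "closed H"
  shows "closed (adjoint_rel H R)"
proof -
  have "adjoint_rel H R =
      H \<times> H \<inter> (\<Inter>w\<in>R. {z. inner (snd z) (fst w) = inner (fst z) (snd w)})"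
    by (fastforce simp: adjoint_rel_def)
  moreover have "closed {z. inner (snd z) (fst w) = inner (fst z) (snd w)}" for w :: "'a \<times> 'a"
    by (intro closed_Collect_eq continuous_intros)
  ultimately show ?thesis
    using assms by (auto intro!: closed_Int closed_Times)
qed

text \<open>For fixed \<open>(x, y)\<close> the defining identity is a closed condition on the pair
  \<open>(u, v)\<close>.\<close>

lemma adjoint_rel_closure: "adjoint_rel H (closure R) = adjoint_rel H R"
proof (intro subset_antisym subrelI)
  fix x y assume xy: "(x, y) \<in> adjoint_rel H R"
  have "closure R \<subseteq> {w. inner y (fst w) = inner x (snd w)}"
  proof (rule closure_minimal)
    show "R \<subseteq> {w. inner y (fst w) = inner x (snd w)}"
      using xy by (auto simp: adjoint_rel_def)
    show "closed {w. inner y (fst w) = inner x (snd w)}"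
      by (intro closed_Collect_eq continuous_intros)
  qed
  then show "(x, y) \<in> adjoint_rel H (closure R)"
    using xy by (auto simp: adjoint_rel_def)
next
  fix x y assume "(x, y) \<in> adjoint_rel H (closure R)"
  then show "(x, y) \<in> adjoint_rel H R"
    using closure_subset[of R] by (auto simp: adjoint_rel_def)
qed

text \<open>The first clause is surjectivity of \<open>L - \<mu>\<close> onto \<open>H\<close>. For
  linear \<open>L\<close> the estimate gives injectivity together with boundedness of the
  inverse.\<close>

definition resolvent_rel :: "'h::real_inner set \<Rightarrow> ('h \<times> 'h) set \<Rightarrow> real set" where
  "resolvent_rel H L = {\<mu>. (\<forall>f\<in>H. \<exists>x. (x, f + \<mu> *\<^sub>R x) \<in> L) \<and>
     (\<exists>C. \<forall>(x, y)\<in>L. norm x \<le> C * norm (y - \<mu> *\<^sub>R x))}"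

section \<open>Laplacians of a Hilbert complex\<close>

text \<open>A closed densely defined operator \<open>D\<close> with \<open>DD = 0\<close> and its
  adjoint \<open>E\<close>: being adjoint relations makes both graphs closed and linear, and
  single-valuedness of each one expresses density of the domain of the other.\<close>

locale hilbert_complex =
  fixes H :: "'h::{real_inner,complete_space} set" and D E :: "('h \<times> 'h) set"
  assumes subspace_H: "subspace H" and closed_H: "closed H"
    and E_eq: "E = adjoint_rel H D" and D_eq: "D = adjoint_rel H E"
    and single_D: "(x, y) \<in> D \<Longrightarrow> (x, z) \<in> D \<Longrightarrow> y = z"
    and single_E: "(x, y) \<in> E \<Longrightarrow> (x, z) \<in> E \<Longrightarrow> y = z"
    and D_D: "(x, y) \<in> D \<Longrightarrow> (y, 0) \<in> D"
begin

section \<open>Elementary rules for the two adjoint operators\<close>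

lemma subspace_D: "subspace D" and subspace_E: "subspace E"
  using subspace_adjoint_rel[OF subspace_H] D_eq E_eq by metis+

lemma closed_E: "closed E"
  using closed_adjoint_rel[OF closed_H] E_eq by metis

lemma closed_D: "closed D"
  using closed_adjoint_rel[OF closed_H] D_eq by metis

lemma D_in: "(x, y) \<in> D \<Longrightarrow> x \<in> H \<and> y \<in> H"
  using adjoint_rel_subset D_eq by fast

lemma E_in: "(x, y) \<in> E \<Longrightarrow> x \<in> H \<and> y \<in> H"
  using adjoint_rel_subset E_eq by fast

text \<open>Dual to \<open>D_D\<close>: if \<open>v\<close> is in the range of \<open>D\<close>,
  then moving \<open>E\<close> across the inner product leaves \<open>D v = 0\<close>.\<close>

lemma E_E: "(x, y) \<in> E \<Longrightarrow> (y, 0) \<in> E"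
proof -
  assume xy: "(x, y) \<in> E"
  have "inner y v = 0" if "(u, v) \<in> D" for u v
    using adjoint_relD[of x y H D v 0] xy D_D[OF that] E_eq by simp
  then show "(y, 0) \<in> E"
    unfolding E_eq adjoint_rel_def using E_in[OF xy] subspace_0[OF subspace_H] by auto
qed

lemma D_add: "(x, y) \<in> D \<Longrightarrow> (u, v) \<in> D \<Longrightarrow> (x + u, y + v) \<in> D"
  using subspace_add[OF subspace_D] by fastforce

lemma E_add: "(x, y) \<in> E \<Longrightarrow> (u, v) \<in> E \<Longrightarrow> (x + u, y + v) \<in> E"
  using subspace_add[OF subspace_E] by fastforce

lemma D_diff: "(x, y) \<in> D \<Longrightarrow> (u, v) \<in> D \<Longrightarrow> (x - u, y - v) \<in> D"
  using subspace_diff[OF subspace_D] by fastforce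

lemma E_diff: "(x, y) \<in> E \<Longrightarrow> (u, v) \<in> E \<Longrightarrow> (x - u, y - v) \<in> E"
  using subspace_diff[OF subspace_E] by fastforce

lemma D_scale: "(x, y) \<in> D \<Longrightarrow> (c *\<^sub>R x, c *\<^sub>R y) \<in> D"
  using subspace_scale[OF subspace_D] by fastforce

lemma E_scale: "(x, y) \<in> E \<Longrightarrow> (c *\<^sub>R x, c *\<^sub>R y) \<in> E"
  using subspace_scale[OF subspace_E] by fastforce

lemma D_E_inner: "(x, y) \<in> D \<Longrightarrow> (u, v) \<in> E \<Longrightarrow> inner y u = inner x v"
  using adjoint_relD D_eq by fast

text \<open>With \<open>E_E\<close> the axioms are symmetric in \<open>D\<close> and
  \<open>E\<close>, so each result also holds with the roles exchanged.\<close>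

lemma swap: "hilbert_complex H E D"
  by unfold_locales (use subspace_H closed_H E_eq D_eq single_D single_E E_E in blast)+

section \<open>The Dirac operator and the resolvents of \<open>ED\<close> and
  \<open>DE\<close>\<close>

definition dirac :: "('h \<times> 'h) set" where
  "dirac = {(x, y + z) | x y z. (x, y) \<in> D \<and> (x, z) \<in> E}"

lemma diracI: "(x, y) \<in> D \<Longrightarrow> (x, z) \<in> E \<Longrightarrow> (x, y + z) \<in> dirac"
  by (auto simp: dirac_def)

text \<open>Von Neumann's argument for \<open>1 + DE\<close>, with \<open>g\<close> the solution of
  \<open>(1 + DE) g = f\<close> and \<open>w = E g\<close>. Projecting \<open>(f, 0)\<close> onto
  the closed graph of \<open>E\<close> leaves a remainder \<open>(f - g, - w)\<close> orthogonal to
  that graph, which says that \<open>w\<close> is in the domain of the adjoint \<open>D\<close> and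
  \<open>D w = f - g\<close>.\<close>

lemma resolvent_of_shift:
  assumes "f \<in> H"
  obtains g w where "(g, w) \<in> E" "(w, f - g) \<in> D" "norm g \<le> norm f" "norm w \<le> norm f"
proof -
  obtain q where q: "q \<in> E" "\<And>v. v \<in> E \<Longrightarrow> inner ((f, 0) - q) v = 0"
    using orthogonal_projection_exists[OF closed_E subspace_E] by blast
  obtain g w where gw: "q = (g, w)" by (cases q)
  have orth: "inner (f - g) u = inner w v" if "(u, v) \<in> E" for u v
    using q(2)[OF that] by (simp add: gw)
  have "(w, f - g) \<in> D"
    unfolding D_eq adjoint_rel_def
    using q(1)[unfolded gw, THEN E_in] subspace_diff[OF subspace_H assms] orth by blast
  \<comment> \<open>Testing the remainder against \<open>(g, w)\<close> itself; both norm bounds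
    come from this identity and the Cauchy-Schwarz inequality.\<close>
  moreover have "inner (f - g) g = inner w w"
    using orth q(1) gw by blast
  then have eq: "inner f g = (norm g)\<^sup>2 + (norm w)\<^sup>2"
    by (simp add: inner_diff_left power2_norm_eq_inner)
  have fg: "inner f g \<le> norm f * norm g" by (rule norm_cauchy_schwarz)
  have "(norm g)\<^sup>2 \<le> norm f * norm g" using eq fg zero_le_power2[of "norm w"] by linarith
  then have g: "norm g \<le> norm f"
    by (cases "g = 0") (simp_all add: power2_eq_square)
  have "norm f * norm g \<le> (norm f)\<^sup>2"
    unfolding power2_eq_square by (intro mult_left_mono g) simp
  then have "(norm w)\<^sup>2 \<le> (norm f)\<^sup>2" using eq fg zero_le_power2[of "norm g"] by linarith
  then have "norm w \<le> norm f" by (rule power2_le_imp_le) simp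
  ultimately show thesis using that q(1) gw g by blast
qed

text \<open>With \<open>R = (1 + DE)\<inverse>\<close>, \<open>g = R f\<close> and \<open>h = E g\<close>, the vector \<open>h\<close> exists for every \<open>f\<close>, whereas \<open>E f\<close>
  need not. Solving \<open>(ED - \<mu>) w = h\<close> and putting \<open>v = (D w - g) / \<mu>\<close> gives \<open>(DE - \<mu>) v = g\<close>, and
  then \<open>v + D w = (1 + DE) v\<close> solves \<open>(DE - \<mu>) x = f\<close>.\<close>

lemma resolvent_swap:
  assumes "\<mu> \<noteq> 0" and mu: "\<mu> \<in> resolvent_rel H (D O E)"
  shows "\<mu> \<in> resolvent_rel H (E O D)"
proof -
  obtain C0 where C0: "\<And>x y. (x, y) \<in> D O E \<Longrightarrow> norm x \<le> C0 * norm (y - \<mu> *\<^sub>R x)"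
    using mu unfolding resolvent_rel_def by blast
  \<comment> \<open>A nonnegative constant is needed for the monotonicity steps below.\<close>
  define C where "C = max C0 0"
  have C: "norm x \<le> C * norm (y - \<mu> *\<^sub>R x)" if "(x, y) \<in> D O E" for x y
    using C0[OF that] mult_right_mono[of C0 C "norm (y - \<mu> *\<^sub>R x)"] by (simp add: C_def)
  have "C \<ge> 0" by (simp add: C_def)
  have sol: "\<exists>x. (x, f + \<mu> *\<^sub>R x) \<in> E O D \<and>
      norm x \<le> (\<bar>(1 + \<mu>) / \<mu>\<bar> * (C * (\<bar>\<mu>\<bar> * C + 1) + 2) + 1) * norm f" if f: "f \<in> H" for f
  proof -
    obtain g h where g: "(g, h) \<in> E" "(h, f - g) \<in> D" "norm g \<le> norm f" "norm h \<le> norm f"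
      using resolvent_of_shift[OF f] .
    have "h \<in> H" using E_in g(1) by blast
    then obtain w where "(w, h + \<mu> *\<^sub>R w) \<in> D O E"
      using mu unfolding resolvent_rel_def by blast
    then obtain y where y: "(w, y) \<in> D" "(y, h + \<mu> *\<^sub>R w) \<in> E" by blast
    have w_le: "norm w \<le> C * norm f"
    proof -
      have "norm w \<le> C * norm (h + \<mu> *\<^sub>R w - \<mu> *\<^sub>R w)" using C y by blast
      also have "\<dots> \<le> C * norm f" using \<open>C \<ge> 0\<close> g(4) by (simp add: mult_left_mono)
      finally show ?thesis .
    qed
    \<comment> \<open>The identity \<open>(norm (D w))\<^sup>2 = <w, ED w>\<close> controls
      \<open>y = D w\<close> through \<open>w\<close> and \<open>ED w\<close>.\<close>
    have y_le: "norm y \<le> (C * (\<bar>\<mu>\<bar> * C + 1) + 1) * norm f"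
    proof -
      have "(norm y)\<^sup>2 = inner w (h + \<mu> *\<^sub>R w)"
        using D_E_inner[OF y] by (simp add: power2_norm_eq_inner)
      also have "\<dots> \<le> norm w * norm (h + \<mu> *\<^sub>R w)" by (rule norm_cauchy_schwarz)
      also have "\<dots> \<le> (C * norm f) * (norm f + \<bar>\<mu>\<bar> * (C * norm f))"
      proof (intro mult_mono w_le)
        show "norm (h + \<mu> *\<^sub>R w) \<le> norm f + \<bar>\<mu>\<bar> * (C * norm f)"
          using norm_triangle_ineq[of h "\<mu> *\<^sub>R w"] g(4) mult_left_mono[OF w_le, of "\<bar>\<mu>\<bar>"] by simp
      qed (use \<open>C \<ge> 0\<close> in auto)
      also have "\<dots> = (C * (\<bar>\<mu>\<bar> * C + 1)) * (norm f)\<^sup>2"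
        by (simp add: power2_eq_square algebra_simps)
      \<comment> \<open>Enlarging the constant \<open>k\<close> to \<open>(k + 1)\<^sup>2\<close>
        makes the right-hand side a square, so that roots can be taken.\<close>
      also have "\<dots> \<le> (C * (\<bar>\<mu>\<bar> * C + 1) + 1)\<^sup>2 * (norm f)\<^sup>2"
      proof (intro mult_right_mono)
        have "k \<le> (k + 1)\<^sup>2" if "0 \<le> k" for k :: real
          using that by (simp add: power2_eq_square algebra_simps)
        then show "C * (\<bar>\<mu>\<bar> * C + 1) \<le> (C * (\<bar>\<mu>\<bar> * C + 1) + 1)\<^sup>2"
          using \<open>C \<ge> 0\<close> by simp
      qed simp
      finally have "(norm y)\<^sup>2 \<le> ((C * (\<bar>\<mu>\<bar> * C + 1) + 1) * norm f)\<^sup>2"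
        by (simp add: power_mult_distrib)
      then show ?thesis
        by (rule power2_le_imp_le) (use \<open>C \<ge> 0\<close> in simp)
    qed
    define v where "v = (1 / \<mu>) *\<^sub>R (y - g)"
    have v_E: "(v, w) \<in> E"
      using E_scale[OF E_diff[OF y(2) g(1)], of "1 / \<mu>"] \<open>\<mu> \<noteq> 0\<close> by (simp add: v_def)
    have y_eq: "y = \<mu> *\<^sub>R v + g" using \<open>\<mu> \<noteq> 0\<close> by (simp add: v_def)
    have "(v + y, w + (h + \<mu> *\<^sub>R w)) \<in> E" using v_E y(2) by (rule E_add)
    moreover have "(w + (h + \<mu> *\<^sub>R w), y + ((f - g) + \<mu> *\<^sub>R y)) \<in> D"
      by (intro D_add D_scale y(1) g(2))
    ultimately have "(v + y, y + ((f - g) + \<mu> *\<^sub>R y)) \<in> E O D" by blast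
    moreover have "y + ((f - g) + \<mu> *\<^sub>R y) = f + \<mu> *\<^sub>R (v + y)"
      by (simp add: y_eq algebra_simps)
    ultimately have 1: "(v + y, f + \<mu> *\<^sub>R (v + y)) \<in> E O D" by simp
    have vy: "v + y = ((1 + \<mu>) / \<mu>) *\<^sub>R (y - g) + g"
      using \<open>\<mu> \<noteq> 0\<close> by (simp add: v_def add_divide_distrib scaleR_add_left)
    have "norm (y - g) \<le> (C * (\<bar>\<mu>\<bar> * C + 1) + 2) * norm f"
      using norm_triangle_ineq4[of y g] y_le g(3) by (simp add: algebra_simps)
    then have "norm (((1 + \<mu>) / \<mu>) *\<^sub>R (y - g)) \<le>
        \<bar>(1 + \<mu>) / \<mu>\<bar> * ((C * (\<bar>\<mu>\<bar> * C + 1) + 2) * norm f)"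
      unfolding norm_scaleR by (rule mult_left_mono) simp
    then have "norm (v + y) \<le> \<bar>(1 + \<mu>) / \<mu>\<bar> * ((C * (\<bar>\<mu>\<bar> * C + 1) + 2) * norm f) + norm f"
      unfolding vy using norm_triangle_ineq[of "((1 + \<mu>) / \<mu>) *\<^sub>R (y - g)" g] g(3) by linarith
    then have "norm (v + y) \<le> (\<bar>(1 + \<mu>) / \<mu>\<bar> * (C * (\<bar>\<mu>\<bar> * C + 1) + 2) + 1) * norm f"
      by (simp only: distrib_right[of _ 1 "norm f"] mult.assoc mult_1_left)
    with 1 show ?thesis by blast
  qed
  \<comment> \<open>If \<open>DE x = \<mu> x\<close>, then \<open>w = E x\<close> satisfies
    \<open>ED w = \<mu> w\<close>; the estimate for \<open>ED\<close> gives \<open>w = 0\<close>,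
    hence \<open>\<mu> x = D w = 0\<close>.\<close>
  have inj: "x = 0" if "(x, \<mu> *\<^sub>R x) \<in> E O D" for x
  proof -
    obtain w where w: "(x, w) \<in> E" "(w, \<mu> *\<^sub>R x) \<in> D"
      using \<open>(x, \<mu> *\<^sub>R x) \<in> E O D\<close> by blast
    have "(w, \<mu> *\<^sub>R w) \<in> D O E" using w(2) E_scale[OF w(1)] by blast
    then have "norm w \<le> C * norm (\<mu> *\<^sub>R w - \<mu> *\<^sub>R w)" by (rule C)
    then have "(0, \<mu> *\<^sub>R x) \<in> D" using w(2) by simp
    moreover have "(0, 0) \<in> D" using subspace_0[OF subspace_D] by (simp add: zero_prod_def)
    ultimately show ?thesis using single_D \<open>\<mu> \<noteq> 0\<close> by (metis scaleR_eq_0_iff)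
  qed
  show ?thesis
    unfolding resolvent_rel_def
  proof (intro CollectI conjI ballI)
    show "\<exists>x. (x, f + \<mu> *\<^sub>R x) \<in> E O D" if "f \<in> H" for f using sol[OF that] by blast
    have "norm x \<le> (\<bar>(1 + \<mu>) / \<mu>\<bar> * (C * (\<bar>\<mu>\<bar> * C + 1) + 2) + 1) * norm (y - \<mu> *\<^sub>R x)"
      if xy: "(x, y) \<in> E O D" for x y
    proof -
      have "y - \<mu> *\<^sub>R x \<in> H"
        using xy E_in D_in subspace_H by (blast intro: subspace_diff subspace_scale)
      \<comment> \<open>The solution constructed for the right-hand side
        \<open>y - \<mu> *\<^sub>R x\<close> must be \<open>x\<close> by injectivity, so the bound
        for constructed solutions holds for every \<open>x\<close> in the domain.\<close>
      then obtain z where z: "(z, y - \<mu> *\<^sub>R x + \<mu> *\<^sub>R z) \<in> E O D"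
          "norm z \<le> (\<bar>(1 + \<mu>) / \<mu>\<bar> * (C * (\<bar>\<mu>\<bar> * C + 1) + 2) + 1) * norm (y - \<mu> *\<^sub>R x)"
        using sol by blast
      obtain a where a: "(x, a) \<in> E" "(a, y) \<in> D" using xy by blast
      obtain b where b: "(z, b) \<in> E" "(b, y - \<mu> *\<^sub>R x + \<mu> *\<^sub>R z) \<in> D" using z(1) by blast
      have "(z - x, (y - \<mu> *\<^sub>R x + \<mu> *\<^sub>R z) - y) \<in> E O D"
        using E_diff[OF b(1) a(1)] D_diff[OF b(2) a(2)] by blast
      then have "z - x = 0" by (intro inj) (simp add: algebra_simps)
      then show ?thesis using z(2) by simp
    qed
    then show "\<exists>C. \<forall>(x, y)\<in>E O D. norm x \<le> C * norm (y - \<mu> *\<^sub>R x)" by blast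
  qed
qed

text \<open>Orthogonal splitting along the closed kernel of \<open>D\<close>. The range of
  \<open>D\<close> lies in this kernel, so the orthogonal part \<open>q\<close> annihilates the
  range of \<open>D\<close> and is therefore in the kernel of the adjoint \<open>E\<close>.\<close>

lemma kernel_decomposition:
  assumes "f \<in> H"
  obtains p q where "f = p + q" "(p, 0) \<in> D" "(q, 0) \<in> E" "\<And>u. (u, 0) \<in> D \<Longrightarrow> inner q u = 0"
proof -
  define N where "N = (\<lambda>x. (x, 0)) -` D"
  have "closed N"
    unfolding N_def by (intro closed_vimage closed_D continuous_intros)
  moreover have "subspace N"
    unfolding N_def using D_add D_scale subspace_0[OF subspace_D]
    by (fastforce simp: subspace_def zero_prod_def)
  ultimately obtain p where p: "p \<in> N" "\<And>v. v \<in> N \<Longrightarrow> inner (f - p) v = 0"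
    using orthogonal_projection_exists by blast
  have "p \<in> H" using p(1) D_in by (auto simp: N_def)
  then have "(f - p, 0) \<in> E"
    unfolding E_eq adjoint_rel_def
    using p(2) D_D assms subspace_diff[OF subspace_H] subspace_0[OF subspace_H] by (auto simp: N_def)
  then show thesis using that[of p "f - p"] p by (auto simp: N_def)
qed

section \<open>The square of the Dirac operator along the kernel splitting\<close>

lemma range_E_orthogonal_kernel: "(x, y) \<in> E \<Longrightarrow> (u, 0) \<in> D \<Longrightarrow> inner y u = 0"
  using D_E_inner[of u 0 x y] by (simp add: inner_commute)

lemma kernel_decomposition_unique:
  assumes "p + q = p' + q'" "(p, 0) \<in> D" "(p', 0) \<in> D"
    and "\<And>u. (u, 0) \<in> D \<Longrightarrow> inner q u = 0" "\<And>u. (u, 0) \<in> D \<Longrightarrow> inner q' u = 0"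
  shows "q = q'"
proof -
  have e: "p - p' = q' - q" using assms(1) by (simp add: algebra_simps)
  have "(p - p', 0) \<in> D" using D_diff[OF assms(2,3)] by simp
  then have "inner (q' - q) (q' - q) = 0"
    unfolding e using assms(4,5) by (simp add: inner_diff_left)
  then show ?thesis by simp
qed

text \<open>As \<open>y = D u\<close> is in the kernel of \<open>D\<close> and
  \<open>z = E u\<close> in the kernel of \<open>E\<close>, subtracting them from
  \<open>y + z\<close> puts \<open>z\<close> into the domain of \<open>D\<close> and
  \<open>y\<close> into the domain of \<open>E\<close>. The mixed terms vanish and
  \<open>DE u + ED u\<close> remains.\<close>

lemma dirac_squaredD:
  assumes "(u, s) \<in> dirac O dirac"
  obtains y z a b where "(u, y) \<in> D" "(u, z) \<in> E" "(z, a) \<in> D" "(y, b) \<in> E" "s = a + b"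
proof -
  obtain t where t: "(u, t) \<in> dirac" "(t, s) \<in> dirac" using assms by blast
  obtain y z where yz: "(u, y) \<in> D" "(u, z) \<in> E" "t = y + z" using t(1) by (auto simp: dirac_def)
  obtain a b where ab: "(t, a) \<in> D" "(t, b) \<in> E" "s = a + b" using t(2) by (auto simp: dirac_def)
  have "(z, a) \<in> D" using D_diff[OF ab(1) D_D[OF yz(1)]] yz(3) by simp
  moreover have "(y, b) \<in> E" using E_diff[OF ab(2) E_E[OF yz(2)]] yz(3) by simp
  ultimately show thesis using that yz ab by blast
qed

lemma dirac_squared_coexact:
  assumes "(x, y) \<in> D" "(y, z) \<in> E" "(x, 0) \<in> E"
  shows "(x, z) \<in> dirac O dirac"
  using diracI[OF assms(1,3)] diracI[OF D_D[OF assms(1)] assms(2)] by auto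

text \<open>Orthogonally to the kernel of \<open>D\<close> the square of the Dirac operator acts as
  \<open>ED\<close>, so its solution can be reused there. On the kernel itself \<open>ED\<close> is
  zero and \<open>ED - \<mu>\<close> is multiplication by \<open>- \<mu>\<close>, invertible because
  \<open>\<mu> \<noteq> 0\<close>.\<close>

lemma resolvent_dirac_squared_imp:
  assumes "\<mu> \<noteq> 0" and mu: "\<mu> \<in> resolvent_rel H (dirac O dirac)"
  shows "\<mu> \<in> resolvent_rel H (D O E)"
proof -
  obtain C where C: "\<And>x y. (x, y) \<in> dirac O dirac \<Longrightarrow> norm x \<le> C * norm (y - \<mu> *\<^sub>R x)"
    using mu unfolding resolvent_rel_def by blast
  have "\<exists>x. (x, f + \<mu> *\<^sub>R x) \<in> D O E" if f: "f \<in> H" for f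
  proof -
    obtain u where u: "(u, f + \<mu> *\<^sub>R u) \<in> dirac O dirac"
      using mu f unfolding resolvent_rel_def by blast
    then obtain y z a b where ab: "(u, y) \<in> D" "(u, z) \<in> E" "(z, a) \<in> D" "(y, b) \<in> E"
        "f + \<mu> *\<^sub>R u = a + b"
      using dirac_squaredD by blast
    obtain f0 f1 where f01: "f = f0 + f1" "(f0, 0) \<in> D" "\<And>u. (u, 0) \<in> D \<Longrightarrow> inner f1 u = 0"
      using kernel_decomposition[OF f] by blast
    have "u \<in> H" using D_in ab(1) by blast
    then obtain u0 u1 where u01: "u = u0 + u1" "(u0, 0) \<in> D" "\<And>v. (v, 0) \<in> D \<Longrightarrow> inner u1 v = 0"
      using kernel_decomposition by blast
    \<comment> \<open>Here \<open>a\<close> is in the range of \<open>D\<close>, hence in its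
      kernel, and \<open>b\<close> is in the range of \<open>E\<close>, orthogonal to that kernel;
      the orthogonal components of \<open>a + b\<close> and \<open>f + \<mu> *\<^sub>R u\<close> are
      compared.\<close>
    have b: "b = f1 + \<mu> *\<^sub>R u1"
    proof (rule kernel_decomposition_unique)
      show "a + b = (f0 + \<mu> *\<^sub>R u0) + (f1 + \<mu> *\<^sub>R u1)"
        using ab(5) f01(1) u01(1) by (simp add: algebra_simps)
      show "(f0 + \<mu> *\<^sub>R u0, 0) \<in> D" using D_add[OF f01(2) D_scale[OF u01(2), of \<mu>]] by simp
    qed (use D_D[OF ab(3)] range_E_orthogonal_kernel[OF ab(4)] f01(3) u01(3) in
        \<open>auto simp: inner_add_left\<close>)
    \<comment> \<open>The kernel component \<open>u0\<close> is replaced by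
      \<open>- f0 / \<mu>\<close>, the solution of \<open>(ED - \<mu>) x = f0\<close> on the kernel
      of \<open>D\<close>.\<close>
    define x where "x = u1 - (1 / \<mu>) *\<^sub>R f0"
    have "(u - u0 - (1 / \<mu>) *\<^sub>R f0, y - 0 - (1 / \<mu>) *\<^sub>R 0) \<in> D"
      by (intro D_diff D_scale ab f01 u01)
    then have "(x, y) \<in> D" by (simp add: x_def u01(1))
    moreover have "f + \<mu> *\<^sub>R x = b" using b f01(1) \<open>\<mu> \<noteq> 0\<close> by (simp add: x_def algebra_simps)
    ultimately show ?thesis using ab(4) by auto
  qed
  moreover have "norm x \<le> (1 / \<bar>\<mu>\<bar> + max C 0) * norm (z - \<mu> *\<^sub>R x)" if "(x, z) \<in> D O E" for x z
  proof -
    obtain y where y: "(x, y) \<in> D" "(y, z) \<in> E" using \<open>(x, z) \<in> D O E\<close> by blast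
    have "x \<in> H" using D_in y(1) by blast
    then obtain x0 x1 where x01: "x = x0 + x1" "(x0, 0) \<in> D" "(x1, 0) \<in> E"
        "\<And>v. (v, 0) \<in> D \<Longrightarrow> inner x1 v = 0"
      using kernel_decomposition by blast
    have "(x1, y) \<in> D" using D_diff[OF y(1) x01(2)] x01(1) by simp
    then have "(x1, z) \<in> dirac O dirac" using y(2) x01(3) by (rule dirac_squared_coexact)
    then have x1: "norm x1 \<le> C * norm (z - \<mu> *\<^sub>R x1)" by (rule C)
    \<comment> \<open>Both \<open>z = ED x\<close> and \<open>x1\<close> are orthogonal to the
      kernel of \<open>D\<close>, so \<open>(ED - \<mu>) x\<close> is the orthogonal sum of
      \<open>(ED - \<mu>) x1\<close> and \<open>- \<mu> x0\<close>.\<close>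
    have "inner (z - \<mu> *\<^sub>R x1) x0 = 0"
      using range_E_orthogonal_kernel[OF y(2) x01(2)] x01(4)[OF x01(2)] by (simp add: inner_diff_left)
    then have "(norm (z - \<mu> *\<^sub>R x))\<^sup>2 = (norm (z - \<mu> *\<^sub>R x1))\<^sup>2 + (\<bar>\<mu>\<bar> * norm x0)\<^sup>2"
      unfolding x01(1) power2_norm_eq_inner power_mult_distrib
      by (simp add: inner_diff_left inner_diff_right inner_add_left inner_add_right inner_commute
          power2_eq_square algebra_simps)
    then have "(norm (z - \<mu> *\<^sub>R x1))\<^sup>2 \<le> (norm (z - \<mu> *\<^sub>R x))\<^sup>2"
        "(\<bar>\<mu>\<bar> * norm x0)\<^sup>2 \<le> (norm (z - \<mu> *\<^sub>R x))\<^sup>2"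
      by simp_all
    then have 1: "norm (z - \<mu> *\<^sub>R x1) \<le> norm (z - \<mu> *\<^sub>R x)" and 2: "\<bar>\<mu>\<bar> * norm x0 \<le> norm (z - \<mu> *\<^sub>R x)"
      by (auto intro: power2_le_imp_le)
    have "norm x1 \<le> max C 0 * norm (z - \<mu> *\<^sub>R x1)"
      using x1 mult_right_mono[of C "max C 0" "norm (z - \<mu> *\<^sub>R x1)"] by simp
    also have "\<dots> \<le> max C 0 * norm (z - \<mu> *\<^sub>R x)" by (intro mult_left_mono 1) simp
    finally have "norm x1 \<le> max C 0 * norm (z - \<mu> *\<^sub>R x)" .
    moreover have "norm x0 \<le> 1 / \<bar>\<mu>\<bar> * norm (z - \<mu> *\<^sub>R x)"
      using 2 \<open>\<mu> \<noteq> 0\<close> by (simp add: field_simps)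
    ultimately show ?thesis
      unfolding distrib_right unfolding x01(1) using norm_triangle_ineq[of x0 x1] by linarith
  qed
  ultimately show ?thesis unfolding resolvent_rel_def by blast
qed

text \<open>The component of \<open>f\<close> in the kernel of \<open>E\<close> is solved with
  \<open>ED\<close>, the one in the kernel of \<open>D\<close> with \<open>DE\<close>. Each solution
  stays in its kernel, where the Dirac square acts as the respective product, so the sum of the two
  solves the equation.\<close>

lemma resolvent_dirac_squared:
  assumes "\<mu> \<noteq> 0" and mu: "\<mu> \<in> resolvent_rel H (D O E)" and mu': "\<mu> \<in> resolvent_rel H (E O D)"
  shows "\<mu> \<in> resolvent_rel H (dirac O dirac)"
proof -
  interpret swapped: hilbert_complex H E D by (rule swap)
  obtain C0 C1 where C0: "\<And>x y. (x, y) \<in> D O E \<Longrightarrow> norm x \<le> C0 * norm (y - \<mu> *\<^sub>R x)"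
    and C1: "\<And>x y. (x, y) \<in> E O D \<Longrightarrow> norm x \<le> C1 * norm (y - \<mu> *\<^sub>R x)"
    using mu mu' unfolding resolvent_rel_def by blast
  have "\<exists>x. (x, f + \<mu> *\<^sub>R x) \<in> dirac O dirac" if f: "f \<in> H" for f
  proof -
    obtain f0 f1 where f01: "f = f0 + f1" "(f0, 0) \<in> D" "(f1, 0) \<in> E"
      using kernel_decomposition[OF f] by blast
    obtain a where "(a, f1 + \<mu> *\<^sub>R a) \<in> D O E"
      using mu E_in f01(3) unfolding resolvent_rel_def by blast
    then obtain y where y: "(a, y) \<in> D" "(y, f1 + \<mu> *\<^sub>R a) \<in> E" by blast
    \<comment> \<open>Dividing \<open>ED a - f1 = \<mu> a\<close> by \<open>\<mu>\<close> exhibits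
      \<open>a\<close> as a combination of vectors in the kernel of \<open>E\<close>.\<close>
    have "((1 / \<mu>) *\<^sub>R (f1 + \<mu> *\<^sub>R a - f1), (1 / \<mu>) *\<^sub>R (0 - 0)) \<in> E"
      by (intro E_scale E_diff f01 E_E[OF y(2)])
    then have "(a, 0) \<in> E" using \<open>\<mu> \<noteq> 0\<close> by simp
    then have A: "(a, f1 + \<mu> *\<^sub>R a) \<in> dirac O dirac" using y dirac_squared_coexact by blast
    obtain b where "(b, f0 + \<mu> *\<^sub>R b) \<in> E O D"
      using mu' D_in f01(2) unfolding resolvent_rel_def by blast
    then obtain z where z: "(b, z) \<in> E" "(z, f0 + \<mu> *\<^sub>R b) \<in> D" by blast
    have "((1 / \<mu>) *\<^sub>R (f0 + \<mu> *\<^sub>R b - f0), (1 / \<mu>) *\<^sub>R (0 - 0)) \<in> D"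
      by (intro D_scale D_diff f01 D_D[OF z(2)])
    then have "(b, 0) \<in> D" using \<open>\<mu> \<noteq> 0\<close> by simp
    have "(a + b, y + z) \<in> dirac"
      using diracI[OF D_add[OF y(1) \<open>(b, 0) \<in> D\<close>] E_add[OF \<open>(a, 0) \<in> E\<close> z(1)]] by simp
    moreover have "(y + z, (f0 + \<mu> *\<^sub>R b) + (f1 + \<mu> *\<^sub>R a)) \<in> dirac"
      using diracI[OF D_add[OF D_D[OF y(1)] z(2)] E_add[OF y(2) E_E[OF z(1)]]] by simp
    moreover have "(f0 + \<mu> *\<^sub>R b) + (f1 + \<mu> *\<^sub>R a) = f + \<mu> *\<^sub>R (a + b)"
      by (simp add: f01(1) algebra_simps)
    ultimately show ?thesis by auto
  qed
  moreover have "norm u \<le> (max C0 0 + max C1 0) * norm (s - \<mu> *\<^sub>R u)" if us: "(u, s) \<in> dirac O dirac" for u s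
  proof -
    obtain y z a b where ab: "(u, y) \<in> D" "(u, z) \<in> E" "(z, a) \<in> D" "(y, b) \<in> E" "s = a + b"
      using dirac_squaredD[OF us] .
    have "u \<in> H" using D_in ab(1) by blast
    then obtain u0 u1 where u01: "u = u0 + u1" "(u0, 0) \<in> D" "(u1, 0) \<in> E"
        "\<And>v. (v, 0) \<in> D \<Longrightarrow> inner u1 v = 0"
      using kernel_decomposition by blast
    have "(u1, y) \<in> D" using D_diff[OF ab(1) u01(2)] u01(1) by simp
    then have c0: "norm u1 \<le> C0 * norm (b - \<mu> *\<^sub>R u1)" using C0 ab(4) by blast
    have "(u0, z) \<in> E" using E_diff[OF ab(2) u01(3)] u01(1) by simp
    then have c1: "norm u0 \<le> C1 * norm (a - \<mu> *\<^sub>R u0)" using C1 ab(3) by blast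
    \<comment> \<open>The residual \<open>a - \<mu> *\<^sub>R u0\<close> is in the kernel of
      \<open>D\<close>, to which \<open>b\<close> and \<open>u1\<close> are orthogonal; hence the
      two residuals are orthogonal and each is bounded by their sum.\<close>
    have "(a - \<mu> *\<^sub>R u0, 0 - \<mu> *\<^sub>R 0) \<in> D"
      by (intro D_diff D_scale u01(2) D_D[OF ab(3)])
    then have "inner (b - \<mu> *\<^sub>R u1) (a - \<mu> *\<^sub>R u0) = 0"
      using range_E_orthogonal_kernel[OF ab(4)] u01(4) by (simp add: inner_diff_left)
    moreover have "s - \<mu> *\<^sub>R u = (b - \<mu> *\<^sub>R u1) + (a - \<mu> *\<^sub>R u0)"
      by (simp add: ab(5) u01(1) algebra_simps)
    ultimately have "(norm (s - \<mu> *\<^sub>R u))\<^sup>2 = (norm (b - \<mu> *\<^sub>R u1))\<^sup>2 + (norm (a - \<mu> *\<^sub>R u0))\<^sup>2"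
      by (simp add: power2_norm_eq_inner inner_add_left inner_add_right inner_commute)
    then have "(norm (b - \<mu> *\<^sub>R u1))\<^sup>2 \<le> (norm (s - \<mu> *\<^sub>R u))\<^sup>2"
        "(norm (a - \<mu> *\<^sub>R u0))\<^sup>2 \<le> (norm (s - \<mu> *\<^sub>R u))\<^sup>2"
      by simp_all
    then have le: "norm (b - \<mu> *\<^sub>R u1) \<le> norm (s - \<mu> *\<^sub>R u)" "norm (a - \<mu> *\<^sub>R u0) \<le> norm (s - \<mu> *\<^sub>R u)"
      by (auto intro: power2_le_imp_le)
    have bd: "c * n \<le> max c 0 * n'" if "0 \<le> n" "n \<le> n'" for c n n' :: real
      using mult_right_mono[of c "max c 0" n] mult_left_mono[of n n' "max c 0"] that by simp
    have "norm u1 \<le> max C0 0 * norm (s - \<mu> *\<^sub>R u)"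
      using c0 bd[OF _ le(1), of C0] by simp
    moreover have "norm u0 \<le> max C1 0 * norm (s - \<mu> *\<^sub>R u)"
      using c1 bd[OF _ le(2), of C1] by simp
    ultimately show ?thesis
      unfolding distrib_right unfolding u01(1) using norm_triangle_ineq[of u0 u1] by linarith
  qed
  ultimately show ?thesis unfolding resolvent_rel_def by blast
qed

lemma resolvent_sets_agree:
  assumes "\<mu> \<noteq> 0"
  shows "\<mu> \<in> resolvent_rel H (D O E) \<longleftrightarrow> \<mu> \<in> resolvent_rel H (dirac O dirac)"
    and "\<mu> \<in> resolvent_rel H (E O D) \<longleftrightarrow> \<mu> \<in> resolvent_rel H (dirac O dirac)"
proof -
  have "\<mu> \<in> resolvent_rel H (D O E) \<longleftrightarrow> \<mu> \<in> resolvent_rel H (E O D)"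
    using resolvent_swap[OF assms] hilbert_complex.resolvent_swap[OF swap assms] by argo
  then show "\<mu> \<in> resolvent_rel H (D O E) \<longleftrightarrow> \<mu> \<in> resolvent_rel H (dirac O dirac)"
    "\<mu> \<in> resolvent_rel H (E O D) \<longleftrightarrow> \<mu> \<in> resolvent_rel H (dirac O dirac)"
    using resolvent_dirac_squared_imp[OF assms] resolvent_dirac_squared[OF assms] by argo+
qed

end

section \<open>Essential self-adjointness of the core Dirac operator\<close>

definition graph_on :: "'a set \<Rightarrow> ('a \<Rightarrow> 'b) \<Rightarrow> ('a \<times> 'b) set" where
  "graph_on C f = (\<lambda>x. (x, f x)) ` C"

text \<open>Modelled on finitely supported cochains, with \<open>d\<close> the coboundary and
  \<open>e\<close> the boundary. Boundaries stay finitely supported, whereas coboundaries are only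
  known to lie in \<open>H\<close>; therefore \<open>e\<close> maps into \<open>C\<close> and
  nilpotency is expressed through \<open>e\<close>.\<close>

locale core_complex =
  fixes H C :: "'h::{real_inner,complete_space} set" and d e :: "'h \<Rightarrow> 'h"
  assumes subspace_H: "subspace H" and closed_H: "closed H"
    and subspace_C: "subspace C" and C_H: "C \<subseteq> H" and dense: "H \<subseteq> closure C"
    and d_in: "x \<in> C \<Longrightarrow> d x \<in> H" and e_in: "x \<in> C \<Longrightarrow> e x \<in> C"
    and green: "x \<in> C \<Longrightarrow> y \<in> C \<Longrightarrow> inner (d x) y = inner x (e y)"
    and e_e: "x \<in> C \<Longrightarrow> e (e x) = 0"
begin

abbreviation "core_d \<equiv> graph_on C d"
abbreviation "core_e \<equiv> graph_on C e"
abbreviation "core_T \<equiv> graph_on C (\<lambda>x. d x + e x)"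

text \<open>Weak extensions: each operator is the adjoint of its formal adjoint on the core. The sum
  \<open>d + e\<close> is its own formal adjoint.\<close>

definition "max_d = adjoint_rel H core_e"
definition "max_e = adjoint_rel H core_d"
definition "max_T = adjoint_rel H core_T"

lemma in_adjoint_graph:
  "(x, y) \<in> adjoint_rel H (graph_on C f) \<longleftrightarrow>
     x \<in> H \<and> y \<in> H \<and> (\<forall>c\<in>C. inner y c = inner x (f c))"
  by (auto simp: adjoint_rel_def graph_on_def)

lemma orthogonal_C_eq_0:
  assumes "x \<in> H" "\<And>c. c \<in> C \<Longrightarrow> inner x c = 0"
  shows "x = 0"
proof -
  have "closure C \<subseteq> {y. inner x y = 0}"
    by (rule closure_minimal) (use assms(2) in \<open>auto intro!: closed_Collect_eq continuous_intros\<close>)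
  then show ?thesis using assms(1) dense by auto
qed

lemma adjoint_graph_single:
  assumes "(x, y) \<in> adjoint_rel H (graph_on C f)" "(x, z) \<in> adjoint_rel H (graph_on C f)"
  shows "y = z"
proof -
  have "y - z = 0"
    by (rule orthogonal_C_eq_0)
      (use assms subspace_diff[OF subspace_H] in \<open>auto simp: in_adjoint_graph inner_diff_left\<close>)
  then show ?thesis by simp
qed

lemma core_d_max: "core_d \<subseteq> max_d" and core_e_max: "core_e \<subseteq> max_e" and core_T_max: "core_T \<subseteq> max_T"
proof -
  have H: "c \<in> H" "d c \<in> H" "e c \<in> H" "d c + e c \<in> H" if "c \<in> C" for c
    using that C_H d_in e_in subspace_add[OF subspace_H] by blast+
  have "inner (e c) c' = inner c (d c')" if "c \<in> C" "c' \<in> C" for c c'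
    using green[OF that(2,1)] by (simp add: inner_commute)
  then show "core_d \<subseteq> max_d" "core_e \<subseteq> max_e" "core_T \<subseteq> max_T"
    unfolding max_d_def max_e_def max_T_def graph_on_def[of C d] graph_on_def[of C e]
      graph_on_def[of C "\<lambda>x. d x + e x"]
    using H green
    by (auto simp: in_adjoint_graph[unfolded graph_on_def] inner_add_left inner_add_right)
qed

lemma closed_max: "closed max_d" "closed max_e" "closed max_T"
  unfolding max_d_def max_e_def max_T_def by (intro closed_adjoint_rel closed_H)+

lemma subspace_max: "subspace max_d" "subspace max_e" "subspace max_T"
  unfolding max_d_def max_e_def max_T_def by (intro subspace_adjoint_rel subspace_H)+

text \<open>Testing against \<open>e c\<close>, again an element of \<open>C\<close>, turns
  \<open>e_e\<close> into nilpotency of \<open>max_d\<close>. The same argument does not apply to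
  \<open>max_e\<close>, since \<open>d c\<close> may leave \<open>C\<close>.\<close>

lemma max_d_d: "(x, y) \<in> max_d \<Longrightarrow> (y, 0) \<in> max_d"
  using e_in e_e subspace_0[OF subspace_H] by (auto simp: max_d_def in_adjoint_graph)

lemma max_sum: "(x, y) \<in> max_d \<Longrightarrow> (x, z) \<in> max_e \<Longrightarrow> (x, y + z) \<in> max_T"
  using subspace_add[OF subspace_H]
  by (auto simp: max_d_def max_e_def max_T_def in_adjoint_graph inner_add_left inner_add_right)

text \<open>Linearity is a consequence of \<open>green\<close>: the graphs of \<open>d\<close> and
  \<open>e\<close> lie in the maximal relations, which are linear and single-valued.\<close>

lemma core_linear:
  assumes "x \<in> C" "y \<in> C"
  shows "d (x - y) = d x - d y" "e (x - y) = e x - e y"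
proof -
  have C: "x - y \<in> C" using subspace_diff[OF subspace_C] assms .
  have gr: "\<And>c. c \<in> C \<Longrightarrow> (c, d c) \<in> max_d" "\<And>c. c \<in> C \<Longrightarrow> (c, e c) \<in> max_e"
    using core_d_max core_e_max by (auto simp: graph_on_def)
  have "(x - y, d x - d y) \<in> max_d" "(x - y, e x - e y) \<in> max_e"
    using subspace_diff[OF subspace_max(1) gr(1) gr(1)] subspace_diff[OF subspace_max(2) gr(2) gr(2)] assms
    by auto
  then show "d (x - y) = d x - d y" "e (x - y) = e x - e y"
    using gr[OF C] adjoint_graph_single unfolding max_d_def max_e_def by blast+
qed

text \<open>The ranges are orthogonal: \<open><d x, e x> = <x, e (e x)> = 0\<close>.\<close>

lemma core_pythagoras:
  assumes "x \<in> C"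
  shows "(norm (d x + e x))\<^sup>2 = (norm (d x))\<^sup>2 + (norm (e x))\<^sup>2"
  using green[OF assms e_in[OF assms]] e_e[OF assms]
  by (simp add: power2_norm_eq_inner inner_add_left inner_add_right inner_commute)

lemma subspace_core:
  "subspace core_d" "subspace core_e"
proof -
  have "subspace (graph_on C f)"
    if "graph_on C f \<subseteq> G" "subspace G" "\<And>x y z. (x, y) \<in> G \<Longrightarrow> (x, z) \<in> G \<Longrightarrow> y = z" for f G
  proof -
    have G: "graph_on C f = G \<inter> C \<times> UNIV"
      using that(1,3) by (auto simp: graph_on_def) blast
    show ?thesis unfolding G
      by (intro subspace_inter that(2) subspace_Times subspace_C subspace_UNIV)
  qed
  then show "subspace core_d" "subspace core_e"
    using core_d_max core_e_max subspace_max adjoint_graph_single unfolding max_d_def max_e_def by metis+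
qed

text \<open>A closed subspace of \<open>G\<close> with trivial orthogonal complement in
  \<open>G\<close> is all of \<open>G\<close>. Orthogonality in the product space is orthogonality
  for the graph inner product.\<close>

lemma closure_core_eqI:
  fixes f :: "'h \<Rightarrow> 'h"
  assumes G: "closed G" "subspace G" "graph_on C f \<subseteq> G" "subspace (graph_on C f)"
    and orth: "\<And>a b. (a, b) \<in> G \<Longrightarrow> (\<And>c. c \<in> C \<Longrightarrow> inner a c + inner b (f c) = 0) \<Longrightarrow> (a, b) = 0"
  shows "closure (graph_on C f) = G"
proof
  have sub: "subspace (closure (graph_on C f))" by (rule subspace_closure[OF G(4)])
  show le: "closure (graph_on C f) \<subseteq> G" by (rule closure_minimal[OF G(3,1)])
  show "G \<subseteq> closure (graph_on C f)"
  proof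
    fix w assume w: "w \<in> G"
    obtain p where p: "p \<in> closure (graph_on C f)"
        "\<And>v. v \<in> closure (graph_on C f) \<Longrightarrow> inner (w - p) v = 0"
      using orthogonal_projection_exists[OF closed_closure sub] by blast
    have mem: "(fst (w - p), snd (w - p)) \<in> G" using subspace_diff[OF G(2) w, of p] p(1) le
      unfolding prod.collapse by blast
    have "inner (fst (w - p)) c + inner (snd (w - p)) (f c) = 0" if "c \<in> C" for c
    proof -
      have "(c, f c) \<in> closure (graph_on C f)"
        using that closure_subset[of "graph_on C f"] by (auto simp: graph_on_def)
      from p(2)[OF this] show ?thesis by (simp add: inner_prod_def)
    qed
    from orth[OF mem this] have "w - p = 0" unfolding prod.collapse .
    then show "w \<in> closure (graph_on C f)" using p(1) by simp
  qed
qed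

text \<open>As \<open>max_T\<close> is the adjoint of \<open>core_T\<close>, the assumed inclusion
  is essential self-adjointness of \<open>core_T\<close>.\<close>

context
  assumes essentially_selfadjoint: "max_T \<subseteq> closure core_T"
begin

text \<open>Approximate \<open>(x, t)\<close> by core elements \<open>c n\<close>. By
  \<open>core_pythagoras\<close> applied to differences, convergence of
  \<open>d (c n) + e (c n)\<close> makes both summands Cauchy, and the closed maximal graphs contain
  the limits. The last claim is the limit of \<open>e (e (c n)) = 0\<close>.\<close>

lemma max_T_split:
  assumes "(x, t) \<in> max_T"
  obtains y z where "(x, y) \<in> max_d" "(x, z) \<in> max_e" "t = y + z" "(z, 0) \<in> max_e"
proof -
  obtain w where w: "\<And>n. w n \<in> core_T" "w \<longlonglongrightarrow> (x, t)"
    using assms essentially_selfadjoint closure_sequential by blast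
  define c where "c n = fst (w n)" for n
  have c: "c n \<in> C" "w n = (c n, d (c n) + e (c n))" for n
    using w(1)[of n] by (auto simp: c_def graph_on_def)
  have cx: "c \<longlonglongrightarrow> x" using tendsto_fst[OF w(2)] by (simp add: c_def[abs_def])
  have Tt: "(\<lambda>n. d (c n) + e (c n)) \<longlonglongrightarrow> t" using tendsto_snd[OF w(2)] c(2) by simp
  have Cau: "Cauchy f"
    if "\<And>m n. norm (f m - f n) \<le> norm ((d (c m) + e (c m)) - (d (c n) + e (c n)))" for f :: "nat \<Rightarrow> 'h"
    using LIMSEQ_imp_Cauchy[OF Tt] that unfolding Cauchy_def dist_norm by (meson le_less_trans)
  have diff: "(norm ((d (c m) + e (c m)) - (d (c n) + e (c n))))\<^sup>2 =
      (norm (d (c m) - d (c n)))\<^sup>2 + (norm (e (c m) - e (c n)))\<^sup>2" for m n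
    using core_pythagoras[OF subspace_diff[OF subspace_C c(1)[of m] c(1)[of n]]]
    by (simp add: core_linear c(1) algebra_simps)
  have "Cauchy (\<lambda>n. d (c n))" "Cauchy (\<lambda>n. e (c n))"
    by (rule Cau, rule power2_le_imp_le, simp_all add: diff)+
  then obtain y z where y: "(\<lambda>n. d (c n)) \<longlonglongrightarrow> y" and z: "(\<lambda>n. e (c n)) \<longlonglongrightarrow> z"
    using Cauchy_convergent_iff convergent_def by metis
  have "(x, y) \<in> max_d"
  proof (rule closed_sequentially[OF closed_max(1)])
    show "(c n, d (c n)) \<in> max_d" for n using core_d_max c(1) by (auto simp: graph_on_def)
    show "(\<lambda>n. (c n, d (c n))) \<longlonglongrightarrow> (x, y)" by (intro tendsto_Pair cx y)
  qed
  moreover have "(x, z) \<in> max_e"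
  proof (rule closed_sequentially[OF closed_max(2)])
    show "(c n, e (c n)) \<in> max_e" for n using core_e_max c(1) by (auto simp: graph_on_def)
    show "(\<lambda>n. (c n, e (c n))) \<longlonglongrightarrow> (x, z)" by (intro tendsto_Pair cx z)
  qed
  moreover have "(z, 0) \<in> max_e"
  proof (rule closed_sequentially[OF closed_max(2)])
    show "(e (c n), 0) \<in> max_e" for n
      using core_e_max e_in[OF c(1)] e_e[OF c(1)] by (force simp: graph_on_def)
    show "(\<lambda>n. (e (c n), 0)) \<longlonglongrightarrow> (z, 0)" by (intro tendsto_Pair z tendsto_const)
  qed
  moreover have "t = y + z" using LIMSEQ_unique[OF Tt] tendsto_add[OF y z] by blast
  ultimately show thesis using that by blast
qed

text \<open>The relation \<open>max_T\<close> is the adjoint of \<open>core_T\<close> and hence of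
  its closure, which contains the second pair.\<close>

lemma max_T_symmetric:
  assumes "(x, y) \<in> max_T" "(u, v) \<in> max_T"
  shows "inner y u = inner x v"
proof -
  have "(u, v) \<in> closure core_T" using assms(2) essentially_selfadjoint by blast
  moreover have "(x, y) \<in> adjoint_rel H (closure core_T)"
    using assms(1) by (simp add: max_T_def adjoint_rel_closure)
  ultimately show ?thesis using adjoint_relD by blast
qed

text \<open>Writing \<open>T a = b\<close> and \<open>T b = - a\<close>, symmetry gives
  \<open>- <a, a> = <T b, a> = <b, T a> = <b, b>\<close>.\<close>

lemma max_T_rotation_eq_0:
  assumes "(a, b) \<in> max_T" "(b, - a) \<in> max_T"
  shows "(a, b) = 0"
proof -
  have "- inner a a = inner b b"
    using max_T_symmetric[OF assms(2,1)] by simp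
  then have "inner a a = 0" "inner b b = 0"
    using inner_ge_zero[of a] inner_ge_zero[of b] by linarith+
  then show ?thesis by (simp add: zero_prod_def)
qed

text \<open>A substitute for nilpotency of \<open>max_e\<close>, available on the domain of
  \<open>max_T\<close> because there the value of \<open>max_e\<close> is a limit of vectors
  \<open>e c\<close>.\<close>

lemma max_e_e_0:
  assumes "(x, y) \<in> max_e" "(x, t) \<in> max_T"
  shows "(y, 0) \<in> max_e"
  using max_T_split[OF assms(2)] assms(1) adjoint_graph_single unfolding max_e_def by metis

text \<open>Graph-orthogonality of \<open>(a, b)\<close> to the core means that \<open>max_e\<close>
  sends \<open>b\<close> to \<open>- a\<close>. Since \<open>b\<close> is in the kernel of
  \<open>max_d\<close> and \<open>a\<close> in that of \<open>max_e\<close>, \<open>max_T\<close>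
  maps \<open>a\<close> to \<open>b\<close> and \<open>b\<close> to \<open>- a\<close>, which forces
  both to vanish.\<close>

lemma closure_core_d: "closure core_d = max_d"
proof (rule closure_core_eqI[OF closed_max(1) subspace_max(1) core_d_max subspace_core(1)])
  fix a b assume ab: "(a, b) \<in> max_d" and orth: "\<And>c. c \<in> C \<Longrightarrow> inner a c + inner b (d c) = 0"
  have H: "a \<in> H" "b \<in> H" using ab by (auto simp: max_d_def in_adjoint_graph)
  have "inner (- a) c = inner b (d c)" if "c \<in> C" for c
    using orth[OF that] by simp
  then have "(b, - a) \<in> max_e"
    using H subspace_neg[OF subspace_H] by (auto simp: max_e_def in_adjoint_graph)
  then have T: "(b, - a) \<in> max_T" using max_sum[OF max_d_d[OF ab]] by simp
  have "(- a, 0) \<in> max_e" using max_e_e_0 \<open>(b, - a) \<in> max_e\<close> T by blast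
  then have "(a, 0) \<in> max_e" using subspace_neg[OF subspace_max(2), of "(- a, 0)"] by simp
  then have "(a, b) \<in> max_T" using max_sum[OF ab] by fastforce
  then show "(a, b) = 0" using T by (rule max_T_rotation_eq_0)
qed

text \<open>Now \<open>max_d\<close> sends \<open>b\<close> to \<open>- a\<close>. Nilpotency of
  \<open>max_d\<close> first puts \<open>(a, b)\<close> into \<open>max_T\<close>; only then does
  \<open>max_e_e_0\<close> apply and place \<open>b\<close> in the kernel of
  \<open>max_e\<close>.\<close>

lemma closure_core_e: "closure core_e = max_e"
proof (rule closure_core_eqI[OF closed_max(2) subspace_max(2) core_e_max subspace_core(2)])
  fix a b assume ab: "(a, b) \<in> max_e" and orth: "\<And>c. c \<in> C \<Longrightarrow> inner a c + inner b (e c) = 0"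
  have H: "a \<in> H" "b \<in> H" using ab by (auto simp: max_e_def in_adjoint_graph)
  have "inner (- a) c = inner b (e c)" if "c \<in> C" for c
    using orth[OF that] by simp
  then have ba: "(b, - a) \<in> max_d"
    using H subspace_neg[OF subspace_H] by (auto simp: max_d_def in_adjoint_graph)
  have "(a, 0) \<in> max_d" using subspace_neg[OF subspace_max(1) max_d_d[OF ba]] by simp
  then have T: "(a, b) \<in> max_T" using max_sum[OF _ ab] by fastforce
  then have "(b, 0) \<in> max_e" using max_e_e_0[OF ab] by blast
  then have "(b, - a) \<in> max_T" using max_sum[OF ba] by fastforce
  with T show "(a, b) = 0" by (rule max_T_rotation_eq_0)
qed

lemma hilbert_complex_max: "hilbert_complex H max_d max_e"
proof
  show "max_e = adjoint_rel H max_d"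
    using adjoint_rel_closure[of H core_d] closure_core_d by (simp add: max_e_def)
  show "max_d = adjoint_rel H max_e"
    using adjoint_rel_closure[of H core_e] closure_core_e by (simp add: max_d_def)
qed (use subspace_H closed_H adjoint_graph_single max_d_d in \<open>auto simp: max_d_def max_e_def\<close>)

lemma dirac_max: "hilbert_complex.dirac max_d max_e = max_T"
proof (intro subset_antisym subrelI)
  interpret hilbert_complex H max_d max_e by (rule hilbert_complex_max)
  show "(x, t) \<in> max_T" if "(x, t) \<in> dirac" for x t
    using that max_sum by (auto simp: dirac_def)
  show "(x, t) \<in> dirac" if "(x, t) \<in> max_T" for x t
    using max_T_split[OF that] diracI by metis
qed

end

end

section \<open>The Hilbert space of square summable functions\<close>

lemma summable_on_mult_of_squares:
  fixes f g :: "'a \<Rightarrow> real"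
  assumes "(\<lambda>x. (f x)\<^sup>2) summable_on A" "(\<lambda>x. (g x)\<^sup>2) summable_on A"
  shows "(\<lambda>x. f x * g x) summable_on A"
proof -
  have "(\<lambda>x. \<bar>f x * g x\<bar>) summable_on A"
  proof (rule summable_on_comparison_test)
    show "(\<lambda>x. (f x)\<^sup>2 + (g x)\<^sup>2) summable_on A" using assms by (rule summable_on_add)
    show "\<bar>f x * g x\<bar> \<le> (f x)\<^sup>2 + (g x)\<^sup>2" for x
    proof -
      have "2 * \<bar>f x * g x\<bar> \<le> (f x)\<^sup>2 + (g x)\<^sup>2"
        using sum_squares_bound[of "\<bar>f x\<bar>" "\<bar>g x\<bar>"] by (simp add: abs_mult mult.assoc)
      moreover have "0 \<le> \<bar>f x * g x\<bar>" by simp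
      ultimately show ?thesis by linarith
    qed
  qed simp
  then show ?thesis using summable_on_iff_abs_summable_on_real by (auto simp: real_norm_def)
qed

lemma summable_on_square_add:
  fixes f g :: "'a \<Rightarrow> real"
  assumes "(\<lambda>x. (f x)\<^sup>2) summable_on A" "(\<lambda>x. (g x)\<^sup>2) summable_on A"
  shows "(\<lambda>x. (f x + g x)\<^sup>2) summable_on A"
proof -
  have "(\<lambda>x. (f x)\<^sup>2 + (g x)\<^sup>2 + 2 * (f x * g x)) summable_on A"
    by (intro summable_on_add summable_on_cmult_right summable_on_mult_of_squares assms)
  then show ?thesis by (simp add: power2_sum mult.assoc)
qed

text \<open>An unweighted real Hilbert space as a type, so that the abstract results apply. The
  weight and the restriction to \<open>\<Sigma>\<close> enter later through coordinates and a closed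
  subspace.\<close>

typedef 'a ell2 = "{f :: 'a \<Rightarrow> real. (\<lambda>x. (f x)\<^sup>2) summable_on UNIV}"
  by (rule exI[of _ "\<lambda>_. 0"]) simp

setup_lifting type_definition_ell2

lemma summable_ell2: "(\<lambda>x. (Rep_ell2 f x)\<^sup>2) summable_on UNIV"
  using Rep_ell2[of f] by simp

lemma summable_ell2_mult: "(\<lambda>x. Rep_ell2 f x * Rep_ell2 g x) summable_on UNIV"
  by (intro summable_on_mult_of_squares summable_ell2)

lemma ell2_eqI: "(\<And>x. Rep_ell2 f x = Rep_ell2 g x) \<Longrightarrow> f = g"
  by (metis Rep_ell2_inject ext)

instantiation ell2 :: (type) real_inner
begin

lift_definition zero_ell2 :: "'a ell2" is "\<lambda>_. 0" by simp
lift_definition plus_ell2 :: "'a ell2 \<Rightarrow> 'a ell2 \<Rightarrow> 'a ell2" is "\<lambda>f g x. f x + g x"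
  by (rule summable_on_square_add)
lift_definition uminus_ell2 :: "'a ell2 \<Rightarrow> 'a ell2" is "\<lambda>f x. - f x" by simp
lift_definition minus_ell2 :: "'a ell2 \<Rightarrow> 'a ell2 \<Rightarrow> 'a ell2" is "\<lambda>f g x. f x - g x"
  using summable_on_square_add[of _ UNIV "\<lambda>x. - _ x"] by simp
lift_definition scaleR_ell2 :: "real \<Rightarrow> 'a ell2 \<Rightarrow> 'a ell2" is "\<lambda>c f x. c * f x"
  by (simp add: power_mult_distrib summable_on_cmult_right)
lift_definition inner_ell2 :: "'a ell2 \<Rightarrow> 'a ell2 \<Rightarrow> real" is "\<lambda>f g. \<Sum>\<^sub>\<infinity>x. f x * g x" .

definition norm_ell2 :: "'a ell2 \<Rightarrow> real" where "norm_ell2 f = sqrt (inner f f)"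
definition dist_ell2 :: "'a ell2 \<Rightarrow> 'a ell2 \<Rightarrow> real" where "dist_ell2 f g = norm (f - g)"
definition sgn_ell2 :: "'a ell2 \<Rightarrow> 'a ell2" where "sgn_ell2 f = inverse (norm f) *\<^sub>R f"
definition uniformity_ell2 :: "('a ell2 \<times> 'a ell2) filter" where
  "uniformity_ell2 = (INF e\<in>{0<..}. principal {(x, y). dist x y < e})"
definition open_ell2 :: "'a ell2 set \<Rightarrow> bool" where
  "open_ell2 U \<longleftrightarrow> (\<forall>x\<in>U. \<forall>\<^sub>F (x', y) in uniformity. x' = x \<longrightarrow> y \<in> U)"

instance
proof
  fix f g h :: "'a ell2" and c k :: real and U :: "'a ell2 set"
  show "f + g + h = f + (g + h)" by transfer (simp add: add.assoc)
  show "f + g = g + f" by transfer (simp add: add.commute)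
  show "0 + f = f" by transfer simp
  show "- f + f = 0" by transfer simp
  show "f - g = f + - g" by transfer simp
  show "c *\<^sub>R (f + g) = c *\<^sub>R f + c *\<^sub>R g" by transfer (simp add: algebra_simps)
  show "(c + k) *\<^sub>R f = c *\<^sub>R f + k *\<^sub>R f" by transfer (simp add: algebra_simps)
  show "c *\<^sub>R k *\<^sub>R f = (c * k) *\<^sub>R f" by transfer (simp add: mult.assoc)
  show "1 *\<^sub>R f = f" by transfer simp
  show "dist f g = norm (f - g)" by (rule dist_ell2_def)
  show "sgn f = inverse (norm f) *\<^sub>R f" by (rule sgn_ell2_def)
  show "uniformity = (INF e\<in>{0<..}. principal {(x, y). dist (x :: 'a ell2) y < e})"
    by (rule uniformity_ell2_def)
  show "open U \<longleftrightarrow> (\<forall>x\<in>U. \<forall>\<^sub>F (x', y) in uniformity. x' = x \<longrightarrow> y \<in> U)"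
    by (rule open_ell2_def)
  show "inner f g = inner g f" by transfer (simp add: mult.commute)
  have "(\<Sum>\<^sub>\<infinity>x. Rep_ell2 f x * Rep_ell2 h x + Rep_ell2 g x * Rep_ell2 h x) =
      (\<Sum>\<^sub>\<infinity>x. Rep_ell2 f x * Rep_ell2 h x) + (\<Sum>\<^sub>\<infinity>x. Rep_ell2 g x * Rep_ell2 h x)"
    by (intro infsum_add summable_ell2_mult)
  then show "inner (f + g) h = inner f h + inner g h"
    by (simp add: inner_ell2.rep_eq plus_ell2.rep_eq distrib_right)
  show "inner (c *\<^sub>R f) g = c * inner f g"
    by (simp add: inner_ell2.rep_eq scaleR_ell2.rep_eq mult.assoc infsum_cmult_right')
  show "0 \<le> inner f f" by transfer (simp add: infsum_nonneg)
  show "inner f f = 0 \<longleftrightarrow> f = 0"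
  proof
    assume "inner f f = 0"
    then have "(\<Sum>\<^sub>\<infinity>x. Rep_ell2 f x * Rep_ell2 f x) = 0" by (simp add: inner_ell2.rep_eq)
    then have "Rep_ell2 f x = 0" for x
      using nonneg_infsum_le_0D[of "\<lambda>x. Rep_ell2 f x * Rep_ell2 f x" UNIV x] summable_ell2_mult[of f f]
      by simp
    then show "f = 0" by (intro ell2_eqI) (simp add: zero_ell2.rep_eq)
  qed (simp add: inner_ell2.rep_eq zero_ell2.rep_eq)
  show "norm f = sqrt (inner f f)" by (rule norm_ell2_def)
qed

end

lemma norm_ell2_power2: "(norm f)\<^sup>2 = (\<Sum>\<^sub>\<infinity>x. (Rep_ell2 f x)\<^sup>2)"
  unfolding power2_norm_eq_inner by (simp add: inner_ell2.rep_eq power2_eq_square)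

lemma sum_squares_le_norm_ell2:
  assumes "finite F"
  shows "(\<Sum>x\<in>F. (Rep_ell2 f x)\<^sup>2) \<le> (norm f)\<^sup>2"
  unfolding norm_ell2_power2 by (rule finite_sum_le_infsum) (use assms summable_ell2 in auto)

lemma abs_Rep_ell2_le_norm: "\<bar>Rep_ell2 f x\<bar> \<le> norm f"
proof -
  have "(\<bar>Rep_ell2 f x\<bar>)\<^sup>2 \<le> (norm f)\<^sup>2" using sum_squares_le_norm_ell2[of "{x}" f] by simp
  then show ?thesis by (rule power2_le_imp_le) simp
qed

lemma bounded_linear_Rep_ell2: "bounded_linear (\<lambda>f. Rep_ell2 f x)"
  by (rule bounded_linear_intro[where K = 1])
    (use abs_Rep_ell2_le_norm in \<open>auto simp: plus_ell2.rep_eq scaleR_ell2.rep_eq\<close>)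

text \<open>Coordinates converge because evaluations are bounded. The Cauchy bound passes to the
  pointwise limit on finite sets, which yields both square summability of the limit and convergence
  in norm.\<close>

instance ell2 :: (type) complete_space
proof
  fix X :: "nat \<Rightarrow> 'a ell2" assume X: "Cauchy X"
  have "Cauchy (\<lambda>n. Rep_ell2 (X n) x)" for x
    using bounded_linear.Cauchy[OF bounded_linear_Rep_ell2 X] .
  then have "\<exists>l. (\<lambda>n. Rep_ell2 (X n) x) \<longlonglongrightarrow> l" for x
    by (simp add: Cauchy_convergent_iff convergent_def)
  then obtain g where g: "\<And>x. (\<lambda>n. Rep_ell2 (X n) x) \<longlonglongrightarrow> g x" by metis
  have lim: "(\<Sum>x\<in>F. (Rep_ell2 (X m) x - g x)\<^sup>2) \<le> e\<^sup>2"
    if "finite F" and "\<And>n. n \<ge> N \<Longrightarrow> norm (X m - X n) \<le> e" for F m N e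
  proof (rule LIMSEQ_le_const2)
    show "(\<lambda>n. \<Sum>x\<in>F. (Rep_ell2 (X m) x - Rep_ell2 (X n) x)\<^sup>2) \<longlonglongrightarrow> (\<Sum>x\<in>F. (Rep_ell2 (X m) x - g x)\<^sup>2)"
      by (intro tendsto_intros g)
    show "\<exists>N. \<forall>n\<ge>N. (\<Sum>x\<in>F. (Rep_ell2 (X m) x - Rep_ell2 (X n) x)\<^sup>2) \<le> e\<^sup>2"
    proof (intro exI allI impI)
      fix n assume "n \<ge> N"
      have "(\<Sum>x\<in>F. (Rep_ell2 (X m) x - Rep_ell2 (X n) x)\<^sup>2) \<le> (norm (X m - X n))\<^sup>2"
        using sum_squares_le_norm_ell2[OF that(1), of "X m - X n"] by (simp add: minus_ell2.rep_eq)
      also have "\<dots> \<le> e\<^sup>2" using that(2)[OF \<open>n \<ge> N\<close>] by (simp add: power_mono)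
      finally show "(\<Sum>x\<in>F. (Rep_ell2 (X m) x - Rep_ell2 (X n) x)\<^sup>2) \<le> e\<^sup>2" .
    qed
  qed
  have summ: "(\<lambda>x. (Rep_ell2 (X m) x - g x)\<^sup>2) summable_on UNIV"
    if "\<And>n. n \<ge> N \<Longrightarrow> norm (X m - X n) \<le> e" for m N e
    by (rule nonneg_bdd_above_summable_on) (auto intro!: bdd_aboveI2 lim[OF _ that])
  obtain N1 where N1: "\<And>m n. m \<ge> N1 \<Longrightarrow> n \<ge> N1 \<Longrightarrow> norm (X m - X n) < 1"
    using X by (metis Cauchy_def dist_norm zero_less_one)
  \<comment> \<open>The limit \<open>g\<close> is a difference of two square summable functions,
    \<open>X N1\<close> and \<open>X N1 - g\<close>.\<close>
  have "(\<lambda>x. (Rep_ell2 (X N1) x + - (Rep_ell2 (X N1) x - g x))\<^sup>2) summable_on UNIV"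
    by (rule summable_on_square_add[OF summable_ell2])
      (use summ[of N1 N1 1] N1 less_imp_le in \<open>auto simp: power2_commute\<close>)
  then have g2: "(\<lambda>x. (g x)\<^sup>2) summable_on UNIV" by simp
  define L where "L = Abs_ell2 g"
  have L: "Rep_ell2 L = g" unfolding L_def by (rule Abs_ell2_inverse) (simp add: g2)
  have "X \<longlonglongrightarrow> L"
  proof (rule metric_LIMSEQ_I)
    fix r :: real assume "r > 0"
    then obtain N where N: "\<And>m n. m \<ge> N \<Longrightarrow> n \<ge> N \<Longrightarrow> norm (X m - X n) < r / 2"
      using X unfolding Cauchy_def dist_norm by (meson half_gt_zero)
    have "dist (X m) L < r" if "m \<ge> N" for m
    proof -
      have le: "norm (X m - X n) \<le> r / 2" if "n \<ge> N" for n
        using N[OF \<open>m \<ge> N\<close> that] by simp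
      have "(norm (X m - L))\<^sup>2 = (\<Sum>\<^sub>\<infinity>x. (Rep_ell2 (X m) x - g x)\<^sup>2)"
        by (simp add: norm_ell2_power2 minus_ell2.rep_eq L)
      also have "\<dots> \<le> (r / 2)\<^sup>2"
        by (rule infsum_le_finite_sums[OF summ[OF le]]) (use lim[OF _ le] in auto)
      finally have "norm (X m - L) \<le> r / 2"
        by (rule power2_le_imp_le) (use \<open>r > 0\<close> in simp)
      then show ?thesis using \<open>r > 0\<close> by (simp add: dist_norm)
    qed
    then show "\<exists>N. \<forall>m\<ge>N. dist (X m) L < r" by blast
  qed
  then show "convergent X" by (auto simp: convergent_def)
qed

section \<open>The weighted cochain spaces\<close>

text \<open>The kind of the formal adjoint: coboundary and boundary are exchanged, their sum is
  formally symmetric.\<close>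

fun adj_kind :: "kind \<Rightarrow> kind" where
  "adj_kind Up = Down" | "adj_kind Down = Up" | "adj_kind Hodge = Hodge"

locale weighted_coboundary =
  fixes S :: "'v set set" and m :: "'v set \<Rightarrow> real" and \<delta> :: "'v cochain \<Rightarrow> 'v cochain"
  assumes finite_simplex: "\<tau> \<in> S \<Longrightarrow> finite \<tau>"
    and m_pos: "\<tau> \<in> S \<Longrightarrow> 0 < m \<tau>"
    and loc_summable: "locally_summable S m"
    and coboundary: "coboundary_operator S \<delta>"
begin

abbreviation "face \<equiv> face_of_codim1 S"
abbreviation "\<theta> \<equiv> incidence \<delta>"
abbreviation "bd \<equiv> boundary S m \<delta>"
abbreviation "L2 \<equiv> l2 S m"

text \<open>Multiplication by \<open>sqrt m\<close> carries the weighted inner product to the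
  unweighted one.\<close>

definition coord :: "'v cochain \<Rightarrow> 'v cochain" where
  "coord \<omega> = (\<lambda>\<tau>. if \<tau> \<in> S then sqrt (m \<tau>) * \<omega> \<tau> else 0)"

definition embed :: "'v cochain \<Rightarrow> 'v set ell2" where
  "embed \<omega> = Abs_ell2 (coord \<omega>)"

definition unembed :: "'v set ell2 \<Rightarrow> 'v cochain" where
  "unembed x = (\<lambda>\<tau>. if \<tau> \<in> S then Rep_ell2 x \<tau> / sqrt (m \<tau>) else 0)"

text \<open>The closed subspace onto which \<open>embed\<close> maps \<open>L2\<close> bijectively
  and isometrically.\<close>

definition H :: "'v set ell2 set" where
  "H = {x. \<forall>\<tau>. \<tau> \<notin> S \<longrightarrow> Rep_ell2 x \<tau> = 0}"

section \<open>The isometry between weighted cochains and \<open>H\<close>\<close>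

lemma coord_mult: "\<tau> \<in> S \<Longrightarrow> coord \<omega> \<tau> * coord \<eta> \<tau> = m \<tau> * \<omega> \<tau> * \<eta> \<tau>"
  using m_pos[of \<tau>] by (simp add: coord_def algebra_simps)

lemma coord_add: "coord (\<lambda>\<tau>. \<omega> \<tau> + c * \<eta> \<tau>) = (\<lambda>\<tau>. coord \<omega> \<tau> + c * coord \<eta> \<tau>)"
  by (auto simp: coord_def algebra_simps)

text \<open>Both the extended real sum and the real sum are suprema of the same finite partial
  sums.\<close>

lemma nsq_eq:
  assumes "(\<lambda>\<tau>. (coord \<omega> \<tau>)\<^sup>2) summable_on UNIV"
  shows "nsq S m \<omega> = ennreal (\<Sum>\<^sub>\<infinity>\<tau>. (coord \<omega> \<tau>)\<^sup>2)"
proof -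
  have sq: "m \<tau> * (\<omega> \<tau>)\<^sup>2 = (coord \<omega> \<tau>)\<^sup>2" if "\<tau> \<in> S" for \<tau>
    using coord_mult[OF that, of \<omega> \<omega>] by (simp add: power2_eq_square)
  have S: "(\<lambda>\<tau>. (coord \<omega> \<tau>)\<^sup>2) summable_on S"
    using summable_on_subset_banach[OF assms] by simp
  have "ennreal (\<Sum>\<^sub>\<infinity>\<tau>\<in>S. (coord \<omega> \<tau>)\<^sup>2) = (SUP F\<in>{F. finite F \<and> F \<subseteq> S}. ennreal (\<Sum>\<tau>\<in>F. (coord \<omega> \<tau>)\<^sup>2))"
    using infsum_nonneg_is_SUPREMUM_ennreal[OF S] by simp
  also have "\<dots> = (SUP F\<in>{F. finite F \<and> F \<subseteq> S}. (\<Sum>\<tau>\<in>F. ennreal (m \<tau> * (\<omega> \<tau>)\<^sup>2)))"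
    by (intro SUP_cong refl) (auto simp: sq subset_iff simp flip: sum_ennreal intro!: sum.cong)
  also have "\<dots> = nsq S m \<omega>"
    unfolding nsq_def by (simp add: nonneg_infsum_complete)
  also have "(\<Sum>\<^sub>\<infinity>\<tau>\<in>S. (coord \<omega> \<tau>)\<^sup>2) = (\<Sum>\<^sub>\<infinity>\<tau>. (coord \<omega> \<tau>)\<^sup>2)"
    by (rule infsum_cong_neutral) (auto simp: coord_def)
  finally show ?thesis by simp
qed

lemma nsq_finite_iff: "nsq S m \<omega> < \<infinity> \<longleftrightarrow> (\<lambda>\<tau>. (coord \<omega> \<tau>)\<^sup>2) summable_on UNIV"
proof
  assume fin: "nsq S m \<omega> < \<infinity>"
  have sq: "m \<tau> * (\<omega> \<tau>)\<^sup>2 = (coord \<omega> \<tau>)\<^sup>2" if "\<tau> \<in> S" for \<tau>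
    using coord_mult[OF that, of \<omega> \<omega>] by (simp add: power2_eq_square)
  have "(\<lambda>\<tau>. (coord \<omega> \<tau>)\<^sup>2) summable_on S"
  proof (rule nonneg_bdd_above_summable_on)
    show "bdd_above (sum (\<lambda>\<tau>. (coord \<omega> \<tau>)\<^sup>2) ` {F. F \<subseteq> S \<and> finite F})"
    proof (rule bdd_aboveI2)
      fix F assume F: "F \<in> {F. F \<subseteq> S \<and> finite F}"
      have "ennreal (\<Sum>\<tau>\<in>F. (coord \<omega> \<tau>)\<^sup>2) = (\<Sum>\<tau>\<in>F. ennreal (m \<tau> * (\<omega> \<tau>)\<^sup>2))"
        using F by (auto simp: sq subset_iff simp flip: sum_ennreal intro!: sum.cong)
      also have "\<dots> \<le> (SUP F\<in>{F. finite F \<and> F \<subseteq> S}. (\<Sum>\<tau>\<in>F. ennreal (m \<tau> * (\<omega> \<tau>)\<^sup>2)))"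
        using F by (intro SUP_upper) auto
      also have "\<dots> = nsq S m \<omega>"
        unfolding nsq_def by (simp add: nonneg_infsum_complete)
      also have "\<dots> = ennreal (enn2real (nsq S m \<omega>))"
        using fin by simp
      finally show "(\<Sum>\<tau>\<in>F. (coord \<omega> \<tau>)\<^sup>2) \<le> enn2real (nsq S m \<omega>)"
        by (simp add: ennreal_le_iff)
    qed
  qed simp
  also have "?this \<longleftrightarrow> (\<lambda>\<tau>. (coord \<omega> \<tau>)\<^sup>2) summable_on UNIV"
    by (rule summable_on_cong_neutral) (auto simp: coord_def)
  finally show "(\<lambda>\<tau>. (coord \<omega> \<tau>)\<^sup>2) summable_on UNIV" .
qed (simp add: nsq_eq)

lemma l2_iff: "\<omega> \<in> L2 \<longleftrightarrow> \<omega> \<in> cochains S \<and> (\<lambda>\<tau>. (coord \<omega> \<tau>)\<^sup>2) summable_on UNIV"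
  using nsq_finite_iff by (simp add: l2_def)

lemma l2_cochains: "\<omega> \<in> L2 \<Longrightarrow> \<omega> \<in> cochains S"
  by (simp add: l2_iff)

lemma l2_add:
  assumes "\<omega> \<in> L2" "\<eta> \<in> L2"
  shows "(\<lambda>\<tau>. \<omega> \<tau> + c * \<eta> \<tau>) \<in> L2"
proof -
  have "(\<lambda>\<tau>. (c * coord \<eta> \<tau>)\<^sup>2) summable_on UNIV"
    using assms(2) by (simp add: l2_iff power_mult_distrib summable_on_cmult_right)
  then show ?thesis
    using assms by (auto simp: l2_iff cochains_def coord_add intro: summable_on_square_add)
qed

lemma Rep_embed: "\<omega> \<in> L2 \<Longrightarrow> Rep_ell2 (embed \<omega>) = coord \<omega>"
  by (simp add: embed_def Abs_ell2_inverse l2_iff)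

lemma embed_in_H: "\<omega> \<in> L2 \<Longrightarrow> embed \<omega> \<in> H"
  by (simp add: H_def Rep_embed) (simp add: coord_def)

lemma coord_unembed: "x \<in> H \<Longrightarrow> coord (unembed x) = Rep_ell2 x"
  using m_pos by (force simp: coord_def unembed_def H_def)

lemma unembed_in_l2: "x \<in> H \<Longrightarrow> unembed x \<in> L2"
  by (simp add: l2_iff coord_unembed summable_ell2) (simp add: cochains_def unembed_def)

lemma embed_unembed: "x \<in> H \<Longrightarrow> embed (unembed x) = x"
  by (simp add: embed_def coord_unembed Rep_ell2_inverse)

lemma unembed_embed: "\<omega> \<in> L2 \<Longrightarrow> unembed (embed \<omega>) = \<omega>"
  using m_pos by (force simp: unembed_def Rep_embed coord_def l2_iff cochains_def)

lemma embed_inject: "\<omega> \<in> L2 \<Longrightarrow> \<eta> \<in> L2 \<Longrightarrow> embed \<omega> = embed \<eta> \<longleftrightarrow> \<omega> = \<eta>"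
  by (metis unembed_embed)

lemma embed_add:
  assumes "\<omega> \<in> L2" "\<eta> \<in> L2"
  shows "embed (\<lambda>\<tau>. \<omega> \<tau> + c * \<eta> \<tau>) = embed \<omega> + c *\<^sub>R embed \<eta>"
  by (rule ell2_eqI)
    (simp add: Rep_embed l2_add assms coord_add plus_ell2.rep_eq scaleR_ell2.rep_eq)

lemma l2_diff: "\<omega> \<in> L2 \<Longrightarrow> \<eta> \<in> L2 \<Longrightarrow> (\<lambda>\<tau>. \<omega> \<tau> - \<eta> \<tau>) \<in> L2"
  using l2_add[of \<omega> \<eta> "-1"] by simp

lemma embed_diff: "\<omega> \<in> L2 \<Longrightarrow> \<eta> \<in> L2 \<Longrightarrow> embed (\<lambda>\<tau>. \<omega> \<tau> - \<eta> \<tau>) = embed \<omega> - embed \<eta>"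
  using embed_add[of \<omega> \<eta> "-1"] by simp

lemma l2_plus: "\<omega> \<in> L2 \<Longrightarrow> \<eta> \<in> L2 \<Longrightarrow> (\<lambda>\<tau>. \<omega> \<tau> + \<eta> \<tau>) \<in> L2"
  using l2_add[of \<omega> \<eta> 1] by simp

lemma embed_plus: "\<omega> \<in> L2 \<Longrightarrow> \<eta> \<in> L2 \<Longrightarrow> embed (\<lambda>\<tau>. \<omega> \<tau> + \<eta> \<tau>) = embed \<omega> + embed \<eta>"
  using embed_add[of \<omega> \<eta> 1] by simp

lemma l2_inner_coord: "l2_inner S m \<omega> \<eta> = (\<Sum>\<^sub>\<infinity>\<tau>. coord \<omega> \<tau> * coord \<eta> \<tau>)"
  unfolding l2_inner_def
  by (rule infsum_cong_neutral) (simp_all add: coord_mult, simp add: coord_def)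

lemma inner_embed: "\<omega> \<in> L2 \<Longrightarrow> \<eta> \<in> L2 \<Longrightarrow> inner (embed \<omega>) (embed \<eta>) = l2_inner S m \<omega> \<eta>"
  by (simp add: l2_inner_coord inner_ell2.rep_eq Rep_embed)

lemma enn2real_nsq: "\<omega> \<in> L2 \<Longrightarrow> enn2real (nsq S m \<omega>) = (norm (embed \<omega>))\<^sup>2"
  by (simp add: l2_iff nsq_eq norm_ell2_power2 Rep_embed infsum_nonneg)

lemma l2_norm_embed: "\<omega> \<in> L2 \<Longrightarrow> l2_norm S m \<omega> = norm (embed \<omega>)"
  by (simp add: l2_norm_def enn2real_nsq)

lemma subspace_H: "subspace H"
  by (auto simp: subspace_def H_def zero_ell2.rep_eq plus_ell2.rep_eq scaleR_ell2.rep_eq)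

lemma closed_H: "closed H"
proof -
  have "H = (\<Inter>\<tau>\<in>-S. {x. Rep_ell2 x \<tau> = 0})" by (auto simp: H_def)
  moreover have "closed {x. Rep_ell2 x \<tau> = 0}" for \<tau> :: "'v set"
    by (intro closed_Collect_eq continuous_intros
        linear_continuous_on bounded_linear_Rep_ell2)
  ultimately show ?thesis by auto
qed

section \<open>Finitely supported cochains and the weighted inner product\<close>

abbreviation "ind \<equiv> (\<lambda>\<tau>. indicat_real {\<tau>}) :: 'v set \<Rightarrow> 'v cochain"

lemma cochains_fin_cochains: "\<phi> \<in> cochains_fin S \<Longrightarrow> \<phi> \<in> cochains S"
  by (simp add: cochains_fin_def)

lemma ind_fin: "\<tau> \<in> S \<Longrightarrow> ind \<tau> \<in> cochains_fin S"
  by (auto simp: cochains_fin_def cochains_def indicator_def)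

lemma zero_fin: "(\<lambda>_. 0) \<in> cochains_fin S"
  by (simp add: cochains_fin_def cochains_def)

lemma fin_add:
  assumes "\<phi> \<in> cochains_fin S" "\<psi> \<in> cochains_fin S"
  shows "(\<lambda>\<tau>. \<phi> \<tau> + c * \<psi> \<tau>) \<in> cochains_fin S"
proof -
  have "{\<tau>. \<phi> \<tau> + c * \<psi> \<tau> \<noteq> 0} \<subseteq> {\<tau>. \<phi> \<tau> \<noteq> 0} \<union> {\<tau>. \<psi> \<tau> \<noteq> 0}" by auto
  moreover have "finite ({\<tau>. \<phi> \<tau> \<noteq> 0} \<union> {\<tau>. \<psi> \<tau> \<noteq> 0})"
    using assms by (simp add: cochains_fin_def)
  ultimately have "finite {\<tau>. \<phi> \<tau> + c * \<psi> \<tau> \<noteq> 0}" by (rule finite_subset)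
  then show ?thesis using assms by (simp add: cochains_fin_def cochains_def)
qed

lemma fin_l2: "\<phi> \<in> cochains_fin S \<Longrightarrow> \<phi> \<in> L2"
proof -
  assume phi: "\<phi> \<in> cochains_fin S"
  then have "finite {\<tau>. \<phi> \<tau> \<noteq> 0}" by (simp add: cochains_fin_def)
  then have "(\<lambda>\<tau>. (coord \<phi> \<tau>)\<^sup>2) summable_on {\<tau>. \<phi> \<tau> \<noteq> 0}" by (rule summable_on_finite)
  also have "?this \<longleftrightarrow> (\<lambda>\<tau>. (coord \<phi> \<tau>)\<^sup>2) summable_on UNIV"
    by (rule summable_on_cong_neutral) (auto simp: coord_def)
  finally show "\<phi> \<in> L2" using phi by (simp add: l2_iff cochains_fin_def)
qed

text \<open>The support is built up one simplex at a time, which reduces identities linear in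
  \<open>\<phi>\<close> to indicators of single simplices.\<close>

lemma cochains_fin_induct [consumes 1, case_names zero add]:
  assumes "\<phi> \<in> cochains_fin S"
    and zero: "P (\<lambda>_. 0)"
    and add: "\<And>\<phi> c \<tau>. \<phi> \<in> cochains_fin S \<Longrightarrow> \<tau> \<in> S \<Longrightarrow> P \<phi> \<Longrightarrow> P (\<lambda>\<rho>. \<phi> \<rho> + c * ind \<tau> \<rho>)"
  shows "P \<phi>"
proof -
  have "P (\<lambda>\<tau>. if \<tau> \<in> F then \<phi> \<tau> else 0) \<and> (\<lambda>\<tau>. if \<tau> \<in> F then \<phi> \<tau> else 0) \<in> cochains_fin S"
    if "finite F" "F \<subseteq> {\<tau>. \<phi> \<tau> \<noteq> 0}" for F
    using that
  proof (induction F rule: finite_induct)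
    case empty
    then show ?case using zero zero_fin by simp
  next
    case (insert \<tau> F)
    have eq: "(\<lambda>\<rho>. if \<rho> \<in> insert \<tau> F then \<phi> \<rho> else 0) =
        (\<lambda>\<rho>. (if \<rho> \<in> F then \<phi> \<rho> else 0) + \<phi> \<tau> * ind \<tau> \<rho>)"
      using insert.hyps by (auto simp: indicator_def)
    have "\<tau> \<in> S" using insert.prems assms(1) by (auto simp: cochains_fin_def cochains_def)
    then show ?case unfolding eq using insert by (auto intro: add fin_add ind_fin)
  qed
  from this[of "{\<tau>. \<phi> \<tau> \<noteq> 0}"] assms(1) have "P (\<lambda>\<tau>. if \<phi> \<tau> \<noteq> 0 then \<phi> \<tau> else 0)"
    by (simp add: cochains_fin_def)
  also have "(\<lambda>\<tau>. if \<phi> \<tau> \<noteq> 0 then \<phi> \<tau> else 0) = \<phi>" by auto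
  finally show ?thesis .
qed

lemma summable_coord_l2:
  "\<omega> \<in> L2 \<Longrightarrow> \<eta> \<in> L2 \<Longrightarrow> (\<lambda>\<tau>. coord \<omega> \<tau> * coord \<eta> \<tau>) summable_on UNIV"
  by (simp add: l2_iff summable_on_mult_of_squares)

lemma summable_coord_fin:
  assumes "\<phi> \<in> cochains_fin S"
  shows "(\<lambda>\<tau>. coord \<psi> \<tau> * coord \<phi> \<tau>) summable_on UNIV"
proof -
  have "(\<lambda>\<tau>. coord \<psi> \<tau> * coord \<phi> \<tau>) summable_on {\<tau>. \<phi> \<tau> \<noteq> 0}"
    using assms by (intro summable_on_finite) (simp add: cochains_fin_def)
  also have "?this \<longleftrightarrow> (\<lambda>\<tau>. coord \<psi> \<tau> * coord \<phi> \<tau>) summable_on UNIV"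
    by (rule summable_on_cong_neutral) (auto simp: coord_def)
  finally show ?thesis .
qed

lemma l2_inner_commute: "l2_inner S m \<omega> \<eta> = l2_inner S m \<eta> \<omega>"
  by (simp add: l2_inner_coord mult.commute)

lemma l2_inner_add_right:
  assumes "(\<lambda>\<tau>. coord \<psi> \<tau> * coord \<phi> \<tau>) summable_on UNIV"
    and "(\<lambda>\<tau>. coord \<psi> \<tau> * coord \<eta> \<tau>) summable_on UNIV"
  shows "l2_inner S m \<psi> (\<lambda>\<tau>. \<phi> \<tau> + c * \<eta> \<tau>) = l2_inner S m \<psi> \<phi> + c * l2_inner S m \<psi> \<eta>"
proof -
  have "(\<Sum>\<^sub>\<infinity>\<tau>. coord \<psi> \<tau> * coord \<phi> \<tau> + c * (coord \<psi> \<tau> * coord \<eta> \<tau>)) =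
      (\<Sum>\<^sub>\<infinity>\<tau>. coord \<psi> \<tau> * coord \<phi> \<tau>) + (\<Sum>\<^sub>\<infinity>\<tau>. c * (coord \<psi> \<tau> * coord \<eta> \<tau>))"
    by (intro infsum_add summable_on_cmult_right assms)
  then show ?thesis
    by (simp add: l2_inner_coord coord_add infsum_cmult_right' algebra_simps)
qed

lemma l2_inner_zero_right: "l2_inner S m \<psi> (\<lambda>_. 0) = 0"
  by (simp add: l2_inner_def)

lemma l2_inner_ind:
  assumes "\<tau> \<in> S"
  shows "l2_inner S m \<psi> (ind \<tau>) = m \<tau> * \<psi> \<tau>"
proof -
  have "l2_inner S m \<psi> (ind \<tau>) = (\<Sum>\<^sub>\<infinity>\<rho>\<in>{\<tau>}. m \<rho> * \<psi> \<rho> * ind \<tau> \<rho>)"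
    unfolding l2_inner_def by (rule infsum_cong_neutral) (use assms in \<open>auto simp: indicator_def\<close>)
  then show ?thesis by simp
qed

section \<open>Green's formulas\<close>

lemma coboundary_cochains: "\<omega> \<in> cochains S \<Longrightarrow> \<delta> \<omega> \<in> cochains S"
  and coboundary_plus: "\<omega> \<in> cochains S \<Longrightarrow> \<eta> \<in> cochains S \<Longrightarrow>
    \<delta> (\<lambda>\<tau>. \<omega> \<tau> + \<eta> \<tau>) = (\<lambda>\<sigma>. \<delta> \<omega> \<sigma> + \<delta> \<eta> \<sigma>)"
  and coboundary_scale: "\<omega> \<in> cochains S \<Longrightarrow> \<delta> (\<lambda>\<tau>. k * \<omega> \<tau>) = (\<lambda>\<sigma>. k * \<delta> \<omega> \<sigma>)"
  and coboundary_coboundary: "\<omega> \<in> cochains S \<Longrightarrow> \<delta> (\<delta> \<omega>) = (\<lambda>\<sigma>. 0)"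
  and incidence_range: "\<tau> \<in> S \<Longrightarrow> \<sigma> \<in> S \<Longrightarrow> \<theta> \<tau> \<sigma> \<in> {-1, 0, 1}"
  and incidence_face: "\<tau> \<in> S \<Longrightarrow> \<sigma> \<in> S \<Longrightarrow> \<theta> \<tau> \<sigma> \<noteq> 0 \<longleftrightarrow> face \<tau> \<sigma>"
  and coboundary_eq: "\<omega> \<in> cochains S \<Longrightarrow> \<sigma> \<in> S \<Longrightarrow>
    \<delta> \<omega> \<sigma> = (\<Sum>\<tau> | face \<tau> \<sigma>. \<omega> \<tau> * \<theta> \<tau> \<sigma>)"
proof -
  note c = coboundary[unfolded coboundary_operator_def]
  note c1 = c[THEN conjunct1] and r1 = c[THEN conjunct2]
  note c2 = r1[THEN conjunct1] and r2 = r1[THEN conjunct2]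
  note c3 = r2[THEN conjunct1] and r3 = r2[THEN conjunct2]
  note c4 = r3[THEN conjunct1] and r4 = r3[THEN conjunct2]
  note c5 = r4[THEN conjunct1] and c6 = r4[THEN conjunct2]
  show "\<omega> \<in> cochains S \<Longrightarrow> \<delta> \<omega> \<in> cochains S" using c1 by blast
  show "\<omega> \<in> cochains S \<Longrightarrow> \<eta> \<in> cochains S \<Longrightarrow>
    \<delta> (\<lambda>\<tau>. \<omega> \<tau> + \<eta> \<tau>) = (\<lambda>\<sigma>. \<delta> \<omega> \<sigma> + \<delta> \<eta> \<sigma>)" using c2 by blast
  show "\<omega> \<in> cochains S \<Longrightarrow> \<delta> (\<lambda>\<tau>. k * \<omega> \<tau>) = (\<lambda>\<sigma>. k * \<delta> \<omega> \<sigma>)" using c3 by blast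
  show "\<omega> \<in> cochains S \<Longrightarrow> \<delta> (\<delta> \<omega>) = (\<lambda>\<sigma>. 0)" using c4 by blast
  show "\<tau> \<in> S \<Longrightarrow> \<sigma> \<in> S \<Longrightarrow> \<theta> \<tau> \<sigma> \<in> {-1, 0, 1}" using c5 by blast
  show "\<tau> \<in> S \<Longrightarrow> \<sigma> \<in> S \<Longrightarrow> \<theta> \<tau> \<sigma> \<noteq> 0 \<longleftrightarrow> face \<tau> \<sigma>" using c5 by blast
  show "\<omega> \<in> cochains S \<Longrightarrow> \<sigma> \<in> S \<Longrightarrow>
    \<delta> \<omega> \<sigma> = (\<Sum>\<tau> | face \<tau> \<sigma>. \<omega> \<tau> * \<theta> \<tau> \<sigma>)" using c6 by blast
qed

lemma coboundary_add:
  assumes "\<omega> \<in> cochains S" "\<eta> \<in> cochains S"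
  shows "\<delta> (\<lambda>\<tau>. \<omega> \<tau> + c * \<eta> \<tau>) = (\<lambda>\<sigma>. \<delta> \<omega> \<sigma> + c * \<delta> \<eta> \<sigma>)"
proof -
  have "(\<lambda>\<tau>. c * \<eta> \<tau>) \<in> cochains S" using assms(2) by (simp add: cochains_def)
  from coboundary_plus[OF assms(1) this] show ?thesis
    by (simp add: coboundary_scale[OF assms(2)])
qed

lemma coboundary_zero: "\<delta> (\<lambda>_. 0) = (\<lambda>_. 0)"
  using coboundary_scale[of "\<lambda>_. 0" 0] by (simp add: cochains_def)

lemma finite_faces: "finite {\<tau>. face \<tau> \<sigma>}"
proof (cases "\<sigma> \<in> S")
  case True
  have "{\<tau>. face \<tau> \<sigma>} \<subseteq> Pow \<sigma>" by (auto simp: face_of_codim1_def)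
  then show ?thesis using finite_simplex[OF True] finite_subset by blast
qed (simp add: face_of_codim1_def)

lemma summable_cofaces:
  assumes "\<tau> \<in> S"
  shows "m summable_on {\<sigma>. face \<tau> \<sigma>}"
  using loc_summable assms by (simp add: locally_summable_def)

text \<open>The estimate \<open>\<bar>\<omega> \<sigma>\<bar> \<le> 1 + (\<omega>
  \<sigma>)\<^sup>2\<close> dominates the sum by one that converges by local summability and one
  bounded by the norm of \<open>\<omega>\<close>.\<close>

lemma summable_l2_cofaces:
  assumes "\<omega> \<in> L2" "\<tau> \<in> S"
  shows "(\<lambda>\<sigma>. m \<sigma> * \<bar>\<omega> \<sigma>\<bar>) summable_on {\<sigma>. face \<tau> \<sigma>}"
proof (rule summable_on_comparison_test)
  have "(\<lambda>\<sigma>. (coord \<omega> \<sigma>)\<^sup>2) summable_on {\<sigma>. face \<tau> \<sigma>}"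
    using assms(1) summable_on_subset_banach by (fastforce simp: l2_iff)
  then show "(\<lambda>\<sigma>. m \<sigma> + (coord \<omega> \<sigma>)\<^sup>2) summable_on {\<sigma>. face \<tau> \<sigma>}"
    by (intro summable_on_add summable_cofaces assms(2))
  fix \<sigma> assume "\<sigma> \<in> {\<sigma>. face \<tau> \<sigma>}"
  then have S: "\<sigma> \<in> S" by (simp add: face_of_codim1_def)
  have "\<bar>\<omega> \<sigma>\<bar> \<le> 1 + (\<omega> \<sigma>)\<^sup>2"
  proof -
    have "2 * \<bar>\<omega> \<sigma>\<bar> \<le> 1 + (\<omega> \<sigma>)\<^sup>2" using sum_squares_bound[of 1 "\<bar>\<omega> \<sigma>\<bar>"] by simp
    then show ?thesis by linarith
  qed
  then have "m \<sigma> * \<bar>\<omega> \<sigma>\<bar> \<le> m \<sigma> * (1 + (\<omega> \<sigma>)\<^sup>2)"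
    using m_pos[OF S] by simp
  also have "\<dots> = m \<sigma> + (coord \<omega> \<sigma>)\<^sup>2"
    using coord_mult[OF S, of \<omega> \<omega>] by (simp add: power2_eq_square algebra_simps)
  finally show "m \<sigma> * \<bar>\<omega> \<sigma>\<bar> \<le> m \<sigma> + (coord \<omega> \<sigma>)\<^sup>2" .
  show "0 \<le> m \<sigma> * \<bar>\<omega> \<sigma>\<bar>" using m_pos[OF S] by simp
qed

lemma l2_cochains1: "\<omega> \<in> L2 \<Longrightarrow> \<omega> \<in> cochains1 S m"
  using summable_l2_cofaces l2_cochains by (simp add: cochains1_def)

lemma abs_incidence_le: "\<tau> \<in> S \<Longrightarrow> \<sigma> \<in> S \<Longrightarrow> \<bar>\<theta> \<tau> \<sigma>\<bar> \<le> 1"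
  using incidence_range[of \<tau> \<sigma>] by auto

lemma summable_boundary:
  assumes "\<omega> \<in> L2" "\<tau> \<in> S"
  shows "(\<lambda>\<sigma>. m \<sigma> * \<omega> \<sigma> * \<theta> \<tau> \<sigma>) summable_on {\<sigma>. face \<tau> \<sigma>}"
proof -
  have "(\<lambda>\<sigma>. \<bar>m \<sigma> * \<omega> \<sigma> * \<theta> \<tau> \<sigma>\<bar>) summable_on {\<sigma>. face \<tau> \<sigma>}"
  proof (rule summable_on_comparison_test[OF summable_l2_cofaces[OF assms]])
    fix \<sigma> assume "\<sigma> \<in> {\<sigma>. face \<tau> \<sigma>}"
    then have S: "\<sigma> \<in> S" by (simp add: face_of_codim1_def)
    show "\<bar>m \<sigma> * \<omega> \<sigma> * \<theta> \<tau> \<sigma>\<bar> \<le> m \<sigma> * \<bar>\<omega> \<sigma>\<bar>"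
      using m_pos[OF S] abs_incidence_le[OF assms(2) S] by (simp add: abs_mult mult_left_le)
  qed simp
  then show ?thesis using summable_on_iff_abs_summable_on_real by (auto simp: real_norm_def)
qed

lemma boundary_cochains: "bd \<omega> \<in> cochains S"
  by (simp add: cochains_def boundary_def)

lemma boundary_add:
  assumes "\<omega> \<in> L2" "\<eta> \<in> L2"
  shows "bd (\<lambda>\<tau>. \<omega> \<tau> + c * \<eta> \<tau>) = (\<lambda>\<sigma>. bd \<omega> \<sigma> + c * bd \<eta> \<sigma>)"
proof
  fix \<rho>
  show "bd (\<lambda>\<tau>. \<omega> \<tau> + c * \<eta> \<tau>) \<rho> = bd \<omega> \<rho> + c * bd \<eta> \<rho>"
  proof (cases "\<rho> \<in> S")
    case True
    have "(\<Sum>\<^sub>\<infinity>\<tau> | face \<rho> \<tau>. m \<tau> * (\<omega> \<tau> + c * \<eta> \<tau>) * \<theta> \<rho> \<tau>) =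
        (\<Sum>\<^sub>\<infinity>\<tau> | face \<rho> \<tau>. m \<tau> * \<omega> \<tau> * \<theta> \<rho> \<tau> + c * (m \<tau> * \<eta> \<tau> * \<theta> \<rho> \<tau>))"
      by (simp add: algebra_simps)
    also have "\<dots> = (\<Sum>\<^sub>\<infinity>\<tau> | face \<rho> \<tau>. m \<tau> * \<omega> \<tau> * \<theta> \<rho> \<tau>) +
        (\<Sum>\<^sub>\<infinity>\<tau> | face \<rho> \<tau>. c * (m \<tau> * \<eta> \<tau> * \<theta> \<rho> \<tau>))"
      by (intro infsum_add summable_on_cmult_right summable_boundary assms True)
    finally show ?thesis
      using True by (simp add: boundary_def infsum_cmult_right' algebra_simps)
  qed (simp add: boundary_def)
qed

lemma boundary_zero: "bd (\<lambda>_. 0) = (\<lambda>_. 0)"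
  by (auto simp: boundary_def)

lemma boundary_ind:
  assumes "\<sigma> \<in> S"
  shows "bd (ind \<sigma>) = (\<lambda>\<tau>. if face \<tau> \<sigma> then m \<sigma> * \<theta> \<tau> \<sigma> / m \<tau> else 0)"
proof
  fix \<tau>
  have "(\<Sum>\<^sub>\<infinity>\<rho> | face \<tau> \<rho>. m \<rho> * ind \<sigma> \<rho> * \<theta> \<tau> \<rho>) =
      (\<Sum>\<^sub>\<infinity>\<rho>\<in>{\<rho>. face \<tau> \<rho> \<and> \<rho> = \<sigma>}. m \<sigma> * \<theta> \<tau> \<sigma>)"
    by (rule infsum_cong_neutral) (auto simp: indicator_def)
  also have "\<dots> = (if face \<tau> \<sigma> then m \<sigma> * \<theta> \<tau> \<sigma> else 0)"
  proof (cases "face \<tau> \<sigma>")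
    case True
    then have "{\<rho>. face \<tau> \<rho> \<and> \<rho> = \<sigma>} = {\<sigma>}" by auto
    then show ?thesis using True by simp
  next
    case False
    then have "{\<rho>. face \<tau> \<rho> \<and> \<rho> = \<sigma>} = {}" by auto
    then show ?thesis using False by simp
  qed
  finally show "bd (ind \<sigma>) \<tau> = (if face \<tau> \<sigma> then m \<sigma> * \<theta> \<tau> \<sigma> / m \<tau> else 0)"
    using face_of_codim1_def[of S \<tau> \<sigma>] by (simp add: boundary_def)
qed

text \<open>A simplex is a finite set and therefore has only finitely many faces.\<close>

lemma boundary_ind_fin: "\<sigma> \<in> S \<Longrightarrow> bd (ind \<sigma>) \<in> cochains_fin S"
  using boundary_cochains[of "ind \<sigma>"] finite_subset[OF _ finite_faces[of \<sigma>]]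
  by (auto simp: cochains_fin_def boundary_ind split: if_splits)

lemma boundary_fin: "\<phi> \<in> cochains_fin S \<Longrightarrow> bd \<phi> \<in> cochains_fin S"
proof (induction rule: cochains_fin_induct)
  case (add \<phi> c \<tau>)
  then show ?case
    by (simp add: boundary_add fin_l2 ind_fin fin_add boundary_ind_fin)
qed (simp add: boundary_zero zero_fin)

text \<open>The squared norm is bounded by the sum of \<open>m\<close> over the cofaces of
  \<open>\<tau>\<close>, which local summability makes finite.\<close>

lemma coboundary_ind_l2:
  assumes "\<tau> \<in> S"
  shows "\<delta> (ind \<tau>) \<in> L2"
proof -
  have "(\<lambda>\<sigma>. (coord (\<delta> (ind \<tau>)) \<sigma>)\<^sup>2) summable_on {\<sigma>. face \<tau> \<sigma>}"
  proof (rule summable_on_comparison_test[OF summable_cofaces[OF assms]])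
    fix \<sigma> assume "\<sigma> \<in> {\<sigma>. face \<tau> \<sigma>}"
    then have S: "\<sigma> \<in> S" by (simp add: face_of_codim1_def)
    have "(\<theta> \<tau> \<sigma>)\<^sup>2 \<le> 1"
      using abs_incidence_le[OF assms S] by (simp add: abs_square_le_1)
    moreover have "(coord (\<delta> (ind \<tau>)) \<sigma>)\<^sup>2 = m \<sigma> * (\<theta> \<tau> \<sigma>)\<^sup>2"
      using coord_mult[OF S, of "\<delta> (ind \<tau>)" "\<delta> (ind \<tau>)"] by (simp add: power2_eq_square incidence_def)
    ultimately show "(coord (\<delta> (ind \<tau>)) \<sigma>)\<^sup>2 \<le> m \<sigma>"
      using m_pos[OF S] by (simp add: mult_left_le)
  qed simp
  also have "?this \<longleftrightarrow> (\<lambda>\<sigma>. (coord (\<delta> (ind \<tau>)) \<sigma>)\<^sup>2) summable_on UNIV"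
    by (rule summable_on_cong_neutral)
      (use incidence_face[OF assms] in \<open>auto simp: coord_def incidence_def\<close>)
  finally show ?thesis
    using coboundary_cochains cochains_fin_cochains[OF ind_fin[OF assms]] by (simp add: l2_iff)
qed

lemma coboundary_fin_l2: "\<phi> \<in> cochains_fin S \<Longrightarrow> \<delta> \<phi> \<in> L2"
proof (induction rule: cochains_fin_induct)
  case zero
  then show ?case by (simp add: coboundary_zero fin_l2 zero_fin)
next
  case (add \<phi> c \<tau>)
  then show ?case
    by (simp add: coboundary_add cochains_fin_cochains ind_fin l2_add coboundary_ind_l2)
qed

text \<open>Arbitrary \<open>\<omega>\<close> are allowed because \<open>\<phi>\<close> and
  \<open>bd \<phi>\<close> have finite support. For the indicator of \<open>\<sigma>\<close> both
  sides are \<open>m \<sigma> * \<delta> \<omega> \<sigma>\<close>.\<close>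

lemma green_coboundary:
  assumes "\<phi> \<in> cochains_fin S" "\<omega> \<in> cochains S"
  shows "l2_inner S m (\<delta> \<omega>) \<phi> = l2_inner S m \<omega> (bd \<phi>)"
  using assms(1)
proof (induction rule: cochains_fin_induct)
  case zero
  then show ?case by (simp add: boundary_zero l2_inner_zero_right)
next
  case (add \<phi> c \<sigma>)
  have "l2_inner S m \<omega> (bd (ind \<sigma>)) = (\<Sum>\<^sub>\<infinity>\<tau> | face \<tau> \<sigma>. m \<sigma> * (\<omega> \<tau> * \<theta> \<tau> \<sigma>))"
    unfolding l2_inner_def boundary_ind[OF add.hyps(2)]
  proof (rule infsum_cong_neutral)
    fix \<tau> assume "\<tau> \<in> S \<inter> {\<tau>. face \<tau> \<sigma>}"
    then show "m \<tau> * \<omega> \<tau> * (if face \<tau> \<sigma> then m \<sigma> * \<theta> \<tau> \<sigma> / m \<tau> else 0) = m \<sigma> * (\<omega> \<tau> * \<theta> \<tau> \<sigma>)"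
      using m_pos[of \<tau>] by (simp add: field_simps)
  qed (auto simp: face_of_codim1_def)
  also have "\<dots> = m \<sigma> * \<delta> \<omega> \<sigma>"
    using finite_faces[of \<sigma>] by (simp add: coboundary_eq[OF assms(2) add.hyps(2)] sum_distrib_left)
  also have "\<dots> = l2_inner S m (\<delta> \<omega>) (ind \<sigma>)" by (simp add: l2_inner_ind add.hyps)
  finally show ?case
    by (simp add: l2_inner_add_right boundary_add fin_l2 ind_fin boundary_fin summable_coord_fin
        add.hyps add.IH)
qed

text \<open>The support of \<open>\<delta> \<phi>\<close> may be infinite, so
  \<open>\<omega>\<close> is taken in \<open>L2\<close> to make the right-hand side converge. For
  the indicator of \<open>\<tau>\<close> both sides are
  \<open>m \<tau> * bd \<omega> \<tau>\<close>.\<close>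

lemma green_boundary:
  assumes "\<phi> \<in> cochains_fin S" "\<omega> \<in> L2"
  shows "l2_inner S m (bd \<omega>) \<phi> = l2_inner S m \<omega> (\<delta> \<phi>)"
  using assms(1)
proof (induction rule: cochains_fin_induct)
  case zero
  then show ?case by (simp add: coboundary_zero l2_inner_zero_right)
next
  case (add \<phi> c \<tau>)
  have "l2_inner S m \<omega> (\<delta> (ind \<tau>)) = (\<Sum>\<^sub>\<infinity>\<sigma> | face \<tau> \<sigma>. m \<sigma> * \<omega> \<sigma> * \<theta> \<tau> \<sigma>)"
    unfolding l2_inner_def incidence_def
    by (rule infsum_cong_neutral)
      (use incidence_face[OF add.hyps(2)] in \<open>auto simp: face_of_codim1_def incidence_def\<close>)
  also have "\<dots> = m \<tau> * bd \<omega> \<tau>"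
    using add.hyps(2) m_pos[OF add.hyps(2)] by (simp add: boundary_def)
  also have "\<dots> = l2_inner S m (bd \<omega>) (ind \<tau>)" by (simp add: l2_inner_ind add.hyps)
  finally show ?case
    by (simp add: l2_inner_add_right coboundary_add cochains_fin_cochains ind_fin
        summable_coord_fin summable_coord_l2 coboundary_fin_l2 assms(2) add.hyps add.IH)
qed

lemma cochain_eqI:
  assumes "\<omega> \<in> cochains S" "\<eta> \<in> cochains S"
    and "\<And>\<phi>. \<phi> \<in> cochains_fin S \<Longrightarrow> l2_inner S m \<omega> \<phi> = l2_inner S m \<eta> \<phi>"
  shows "\<omega> = \<eta>"
proof
  fix \<tau>
  show "\<omega> \<tau> = \<eta> \<tau>"
  proof (cases "\<tau> \<in> S")
    case True
    then have "m \<tau> * \<omega> \<tau> = m \<tau> * \<eta> \<tau>"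
      using assms(3)[OF ind_fin[OF True]] by (simp add: l2_inner_ind)
    then show ?thesis using m_pos[OF True] by simp
  qed (use assms in \<open>simp add: cochains_def\<close>)
qed

text \<open>Dual to \<open>\<delta>\<delta> = 0\<close>: both of Green's formulas move the two
  boundaries onto the test cochain.\<close>

lemma boundary_boundary_fin:
  assumes "\<phi> \<in> cochains_fin S"
  shows "bd (bd \<phi>) = (\<lambda>_. 0)"
proof (rule cochain_eqI)
  fix \<psi> assume psi: "\<psi> \<in> cochains_fin S"
  have C: "\<psi> \<in> cochains S" using psi by (rule cochains_fin_cochains)
  have "l2_inner S m (bd (bd \<phi>)) \<psi> = l2_inner S m (bd \<phi>) (\<delta> \<psi>)"
    by (intro green_boundary psi fin_l2 boundary_fin assms)
  also have "\<dots> = l2_inner S m (\<delta> (\<delta> \<psi>)) \<phi>"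
    using green_coboundary[OF assms coboundary_cochains[OF C]] by (simp add: l2_inner_commute)
  finally show "l2_inner S m (bd (bd \<phi>)) \<psi> = l2_inner S m (\<lambda>_. 0) \<psi>"
    by (simp add: coboundary_coboundary[OF C] l2_inner_def)
qed (use boundary_cochains in \<open>auto simp: cochains_def\<close>)

section \<open>The Laplacians as relations\<close>

fun op_of :: "kind \<Rightarrow> 'v cochain \<Rightarrow> 'v cochain" where
  "op_of Up \<omega> = \<delta> \<omega>"
| "op_of Down \<omega> = bd \<omega>"
| "op_of Hodge \<omega> = (\<lambda>\<tau>. \<delta> \<omega> \<tau> + bd \<omega> \<tau>)"

lemma op_cochains: "\<omega> \<in> cochains S \<Longrightarrow> op_of k \<omega> \<in> cochains S"
  using coboundary_cochains[of \<omega>] boundary_cochains[of \<omega>]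
  by (cases k) (simp_all add: cochains_def)

lemma op_add:
  assumes "\<omega> \<in> L2" "\<eta> \<in> L2"
  shows "op_of k (\<lambda>\<tau>. \<omega> \<tau> + c * \<eta> \<tau>) = (\<lambda>\<sigma>. op_of k \<omega> \<sigma> + c * op_of k \<eta> \<sigma>)"
  using assms by (cases k) (simp_all add: coboundary_add boundary_add l2_cochains algebra_simps)

lemma op_plus: "\<omega> \<in> L2 \<Longrightarrow> \<eta> \<in> L2 \<Longrightarrow> op_of k (\<lambda>\<tau>. \<omega> \<tau> + \<eta> \<tau>) = (\<lambda>\<sigma>. op_of k \<omega> \<sigma> + op_of k \<eta> \<sigma>)"
  using op_add[of \<omega> \<eta> k 1] by simp

lemma op_diff: "\<omega> \<in> L2 \<Longrightarrow> \<eta> \<in> L2 \<Longrightarrow> op_of k (\<lambda>\<tau>. \<omega> \<tau> - \<eta> \<tau>) = (\<lambda>\<sigma>. op_of k \<omega> \<sigma> - op_of k \<eta> \<sigma>)"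
  using op_add[of \<omega> \<eta> k "-1"] by simp

lemma op_fin_l2: "\<phi> \<in> cochains_fin S \<Longrightarrow> op_of k \<phi> \<in> L2"
  by (cases k) (simp_all add: coboundary_fin_l2 fin_l2 boundary_fin l2_plus)

lemma green:
  assumes "\<omega> \<in> L2" "\<phi> \<in> cochains_fin S"
  shows "l2_inner S m (op_of k \<omega>) \<phi> = l2_inner S m \<omega> (op_of (adj_kind k) \<phi>)"
proof (cases k)
  case Hodge
  have "l2_inner S m (\<lambda>\<tau>. \<delta> \<omega> \<tau> + bd \<omega> \<tau>) \<phi> = l2_inner S m (\<delta> \<omega>) \<phi> + l2_inner S m (bd \<omega>) \<phi>"
    using l2_inner_add_right[of \<phi> "\<delta> \<omega>" "bd \<omega>" 1] summable_coord_fin[OF assms(2)]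
    by (simp add: l2_inner_commute[of _ \<phi>] mult.commute[of "coord \<phi> _"])
  also have "\<dots> = l2_inner S m \<omega> (bd \<phi>) + l2_inner S m \<omega> (\<delta> \<phi>)"
    using assms by (simp add: green_coboundary green_boundary l2_cochains)
  also have "\<dots> = l2_inner S m \<omega> (\<lambda>\<tau>. \<delta> \<phi> \<tau> + bd \<phi> \<tau>)"
    using l2_inner_add_right[of \<omega> "\<delta> \<phi>" "bd \<phi>" 1] assms
    by (simp add: summable_coord_l2 coboundary_fin_l2 fin_l2 boundary_fin)
  finally show ?thesis by (simp add: Hodge)
qed (use assms in \<open>simp_all add: green_coboundary green_boundary l2_cochains\<close>)

section \<open>Cores and maximal operators in the Hilbert space\<close>

definition core :: "'v set ell2 set" where
  "core = embed ` cochains_fin S"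

definition core_op :: "kind \<Rightarrow> 'v set ell2 \<Rightarrow> 'v set ell2" where
  "core_op k x = embed (op_of k (unembed x))"

text \<open>The graph of \<open>op_of k\<close> with maximal domain, which is the domain of
  \<open>form_N S m \<delta> k\<close>.\<close>

definition max_graph :: "kind \<Rightarrow> ('v set ell2 \<times> 'v set ell2) set" where
  "max_graph k = {(embed \<omega>, embed (op_of k \<omega>)) | \<omega>. \<omega> \<in> L2 \<and> op_of k \<omega> \<in> L2}"

lemma core_op_embed: "\<phi> \<in> cochains_fin S \<Longrightarrow> core_op k (embed \<phi>) = embed (op_of k \<phi>)"
  by (simp add: core_op_def unembed_embed fin_l2)

lemma graph_on_core: "graph_on core (core_op k) = {(embed \<phi>, embed (op_of k \<phi>)) | \<phi>. \<phi> \<in> cochains_fin S}"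
  by (auto simp: graph_on_def core_def core_op_embed)

lemma max_graph_iff:
  assumes "\<omega> \<in> L2" "\<eta> \<in> L2"
  shows "(embed \<omega>, embed \<eta>) \<in> max_graph k \<longleftrightarrow> \<eta> = op_of k \<omega>"
  using assms by (auto simp: max_graph_def embed_inject)

lemma max_graph_in:
  assumes "(x, y) \<in> max_graph k"
  obtains \<omega> where "\<omega> \<in> L2" "op_of k \<omega> \<in> L2" "x = embed \<omega>" "y = embed (op_of k \<omega>)"
  using assms by (auto simp: max_graph_def)

text \<open>Weak and pointwise definitions agree: Green's formulas give one inclusion, and the other
  holds because a cochain is determined by its pairings with finitely supported ones.\<close>

lemma max_graph_eq_adjoint: "max_graph k = adjoint_rel H (graph_on core (core_op (adj_kind k)))"
proof (intro subset_antisym subrelI)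
  fix x y assume "(x, y) \<in> max_graph k"
  then obtain \<omega> where w: "\<omega> \<in> L2" "op_of k \<omega> \<in> L2" "x = embed \<omega>" "y = embed (op_of k \<omega>)"
    by (rule max_graph_in)
  have "inner y (embed \<phi>) = inner x (embed (op_of (adj_kind k) \<phi>))" if "\<phi> \<in> cochains_fin S" for \<phi>
    using green[OF w(1) that, of k] that by (simp add: w inner_embed fin_l2 op_fin_l2)
  then show "(x, y) \<in> adjoint_rel H (graph_on core (core_op (adj_kind k)))"
    using w by (auto simp: adjoint_rel_def graph_on_core embed_in_H)
next
  fix x y assume xy: "(x, y) \<in> adjoint_rel H (graph_on core (core_op (adj_kind k)))"
  then have H: "x \<in> H" "y \<in> H" by (auto simp: adjoint_rel_def)
  have "unembed y = op_of k (unembed x)"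
  proof (rule cochain_eqI)
    fix \<phi> assume phi: "\<phi> \<in> cochains_fin S"
    have "inner y (embed \<phi>) = inner x (embed (op_of (adj_kind k) \<phi>))"
      using adjoint_relD[OF xy] phi by (auto simp: graph_on_core)
    then have "l2_inner S m (unembed y) \<phi> = l2_inner S m (unembed x) (op_of (adj_kind k) \<phi>)"
      using H phi by (simp flip: inner_embed add: unembed_in_l2 fin_l2 op_fin_l2 embed_unembed)
    then show "l2_inner S m (unembed y) \<phi> = l2_inner S m (op_of k (unembed x)) \<phi>"
      using green[OF unembed_in_l2[OF H(1)] phi] by simp
  qed (use H in \<open>simp_all add: unembed_in_l2 l2_cochains op_cochains\<close>)
  then have "(embed (unembed x), embed (unembed y)) \<in> max_graph k"
    using max_graph_iff[OF unembed_in_l2[OF H(1)] unembed_in_l2[OF H(2)]] by blast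
  then show "(x, y) \<in> max_graph k" using H by (simp add: embed_unembed)
qed

lemma subspace_core: "subspace core"
proof -
  have z: "embed (\<lambda>_. 0) = 0"
    using embed_diff[OF fin_l2[OF zero_fin] fin_l2[OF zero_fin]] by simp
  have s: "c *\<^sub>R embed \<phi> = embed (\<lambda>\<tau>. 0 + c * \<phi> \<tau>)" if "\<phi> \<in> cochains_fin S" for c \<phi>
    by (subst embed_add) (use that z in \<open>simp_all add: fin_l2 zero_fin\<close>)
  show ?thesis
    unfolding subspace_def core_def
  proof (intro conjI ballI allI)
    show "0 \<in> embed ` cochains_fin S" using z zero_fin by force
    fix x y and c :: real assume "x \<in> embed ` cochains_fin S" "y \<in> embed ` cochains_fin S"
    then obtain \<phi> \<psi> where p: "x = embed \<phi>" "y = embed \<psi>" "\<phi> \<in> cochains_fin S" "\<psi> \<in> cochains_fin S"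
      by blast
    show "x + y \<in> embed ` cochains_fin S"
      using p fin_add[of \<phi> \<psi> 1] embed_plus[of \<phi> \<psi>] by (force simp: fin_l2)
    show "c *\<^sub>R x \<in> embed ` cochains_fin S"
      using s[OF p(3)] fin_add[OF zero_fin p(3), of c] p(1) by blast
  qed
qed

lemma core_subset_H: "core \<subseteq> H"
  by (auto simp: core_def embed_in_H fin_l2)

text \<open>The part of \<open>x\<close> orthogonal to \<open>core\<close> pairs to zero with every
  finitely supported cochain and so vanishes.\<close>

lemma core_dense: "H \<subseteq> closure core"
proof
  fix x assume x: "x \<in> H"
  obtain p where p: "p \<in> closure core" "\<And>v. v \<in> closure core \<Longrightarrow> inner (x - p) v = 0"
    using orthogonal_projection_exists[OF closed_closure subspace_closure[OF subspace_core]] by blast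
  have "p \<in> H" using p(1) closure_minimal[OF core_subset_H closed_H] by blast
  then have xp: "x - p \<in> H" using subspace_diff[OF subspace_H x] by blast
  have "unembed (x - p) = (\<lambda>_. 0)"
  proof (rule cochain_eqI)
    fix \<phi> assume phi: "\<phi> \<in> cochains_fin S"
    have "inner (embed (unembed (x - p))) (embed \<phi>) = 0"
      using p(2) phi closure_subset[of core] by (auto simp: embed_unembed[OF xp] core_def)
    then show "l2_inner S m (unembed (x - p)) \<phi> = l2_inner S m (\<lambda>_. 0) \<phi>"
      using phi xp by (simp add: inner_embed unembed_in_l2 fin_l2) (simp add: l2_inner_def)
  qed (use xp in \<open>simp_all add: unembed_in_l2 l2_cochains cochains_fin_cochains zero_fin\<close>)
  then have "x - p = embed (\<lambda>_. 0)" using embed_unembed[OF xp] by simp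
  also have "\<dots> = 0"
    using embed_diff[OF fin_l2[OF zero_fin] fin_l2[OF zero_fin]] by simp
  finally show "x \<in> closure core" using p(1) by simp
qed

lemma core_complex_cochains: "core_complex H core (core_op Up) (core_op Down)"
proof
  show "core_op Up x \<in> H" if "x \<in> core" for x
    using that op_fin_l2[of _ Up] by (auto simp: core_def core_op_embed embed_in_H)
  show "core_op Down x \<in> core" if "x \<in> core" for x
    using that by (auto simp: core_def core_op_embed boundary_fin)
  show "inner (core_op Up x) y = inner x (core_op Down y)" if "x \<in> core" "y \<in> core" for x y
    using that green[of _ _ Up] op_fin_l2[of _ Up] op_fin_l2[of _ Down]
    by (auto simp: core_def core_op_embed inner_embed fin_l2)
  show "core_op Down (core_op Down x) = 0" if "x \<in> core" for x
    using that embed_diff[OF fin_l2[OF zero_fin] fin_l2[OF zero_fin]]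
    by (auto simp: core_def core_op_embed boundary_fin boundary_boundary_fin)
qed (simp_all add: subspace_H closed_H subspace_core core_subset_H core_dense)

interpretation cc: core_complex H core "core_op Up" "core_op Down"
  by (rule core_complex_cochains)

lemma core_op_Hodge: "x \<in> core \<Longrightarrow> core_op Hodge x = core_op Up x + core_op Down x"
  by (auto simp: core_def core_op_embed embed_plus coboundary_fin_l2 boundary_fin fin_l2)

lemma graph_on_Hodge: "graph_on core (core_op Hodge) = cc.core_T"
  unfolding graph_on_def by (intro image_cong refl) (simp add: core_op_Hodge)

lemma max_graph_max:
  "max_graph Up = cc.max_d" "max_graph Down = cc.max_e" "max_graph Hodge = cc.max_T"
  by (simp_all add: max_graph_eq_adjoint cc.max_d_def cc.max_e_def cc.max_T_def graph_on_Hodge)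

section \<open>The quadratic forms\<close>

lemma form_N_eq:
  "form_N S m \<delta> k \<omega> =
    (if \<omega> \<in> L2 \<and> op_of k \<omega> \<in> L2 then Some ((norm (embed (op_of k \<omega>)))\<^sup>2) else None)"
proof -
  have "energy S m \<delta> k \<omega> = nsq S m (op_of k \<omega>)" by (cases k) simp_all
  moreover have "\<omega> \<in> L2 \<Longrightarrow> \<omega> \<in> energy_domain S m k"
    by (cases k) (simp_all add: l2_cochains l2_cochains1)
  moreover have "\<omega> \<in> L2 \<Longrightarrow> nsq S m (op_of k \<omega>) < \<infinity> \<longleftrightarrow> op_of k \<omega> \<in> L2"
    using op_cochains[OF l2_cochains] by (simp add: l2_def)
  ultimately show ?thesis
    by (auto simp: form_N_def enn2real_nsq)
qed

lemma dom_form_N: "dom (form_N S m \<delta> k) = {\<omega>. \<omega> \<in> L2 \<and> op_of k \<omega> \<in> L2}"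
  by (auto simp: form_N_eq split: if_splits)

lemma form_norm_eq:
  assumes "\<omega> \<in> L2" "op_of k \<omega> \<in> L2"
  shows "form_norm S m (form_N S m \<delta> k) \<omega> = norm (embed \<omega>, embed (op_of k \<omega>))"
  using assms by (simp add: form_norm_def form_N_eq l2_norm_embed norm_prod_def add.commute)

text \<open>The form norm is the graph norm of \<open>op_of k\<close>, so the form closure is a
  closure in the product space.\<close>

lemma form_closure_eq:
  "form_closure S m (form_N S m \<delta> k) (cochains_fin S) =
    {\<omega>. \<omega> \<in> L2 \<and> op_of k \<omega> \<in> L2 \<and>
      (embed \<omega>, embed (op_of k \<omega>)) \<in> closure (graph_on core (core_op k))}"
proof -
  have fin: "cochains_fin S \<inter> dom (form_N S m \<delta> k) = cochains_fin S"
    by (auto simp: dom_form_N fin_l2 op_fin_l2)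
  have "form_norm S m (form_N S m \<delta> k) (\<lambda>\<tau>. \<omega> \<tau> - \<phi> \<tau>) =
      dist (embed \<phi>, embed (op_of k \<phi>)) (embed \<omega>, embed (op_of k \<omega>))"
    if "\<omega> \<in> L2" "op_of k \<omega> \<in> L2" "\<phi> \<in> cochains_fin S" for \<omega> \<phi>
  proof -
    have "form_norm S m (form_N S m \<delta> k) (\<lambda>\<tau>. \<omega> \<tau> - \<phi> \<tau>) =
        norm (embed (\<lambda>\<tau>. \<omega> \<tau> - \<phi> \<tau>), embed (op_of k (\<lambda>\<tau>. \<omega> \<tau> - \<phi> \<tau>)))"
      by (rule form_norm_eq) (use that in \<open>simp_all add: op_diff l2_diff fin_l2 op_fin_l2\<close>)
    also have "\<dots> = norm ((embed \<omega>, embed (op_of k \<omega>)) - (embed \<phi>, embed (op_of k \<phi>)))"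
      using that by (simp add: op_diff embed_diff fin_l2 op_fin_l2)
    also have "\<dots> = dist (embed \<omega>, embed (op_of k \<omega>)) (embed \<phi>, embed (op_of k \<phi>))"
      by (rule dist_norm[symmetric])
    also have "\<dots> = dist (embed \<phi>, embed (op_of k \<phi>)) (embed \<omega>, embed (op_of k \<omega>))"
      by (rule dist_commute)
    finally show ?thesis .
  qed
  moreover have "graph_on core (core_op k) = (\<lambda>\<phi>. (embed \<phi>, embed (op_of k \<phi>))) ` cochains_fin S"
    unfolding graph_on_core by blast
  ultimately have "(\<forall>\<epsilon>>0. \<exists>\<phi>\<in>cochains_fin S. form_norm S m (form_N S m \<delta> k) (\<lambda>\<tau>. \<omega> \<tau> - \<phi> \<tau>) < \<epsilon>) \<longleftrightarrow>
      (embed \<omega>, embed (op_of k \<omega>)) \<in> closure (graph_on core (core_op k))"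
    if "\<omega> \<in> L2" "op_of k \<omega> \<in> L2" for \<omega>
    using that by (simp add: closure_approachable)
  then show ?thesis
    unfolding form_closure_def fin by (auto simp: dom_form_N)
qed

text \<open>Translates equality of the two forms into a core property; for \<open>Hodge\<close> it
  is essential self-adjointness of the core Dirac operator.\<close>

lemma form_D_eq_form_N_iff:
  "form_D S m \<delta> k = form_N S m \<delta> k \<longleftrightarrow> max_graph k \<subseteq> closure (graph_on core (core_op k))"
proof
  assume eq: "form_D S m \<delta> k = form_N S m \<delta> k"
  have "dom (form_D S m \<delta> k) \<subseteq> form_closure S m (form_N S m \<delta> k) (cochains_fin S)"
    by (simp add: form_D_def)
  then have "dom (form_N S m \<delta> k) \<subseteq> form_closure S m (form_N S m \<delta> k) (cochains_fin S)"
    by (simp only: eq)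
  then show "max_graph k \<subseteq> closure (graph_on core (core_op k))"
    by (auto simp: form_closure_eq dom_form_N max_graph_def)
next
  assume "max_graph k \<subseteq> closure (graph_on core (core_op k))"
  then have "dom (form_N S m \<delta> k) \<subseteq> form_closure S m (form_N S m \<delta> k) (cochains_fin S)"
    by (auto simp: form_closure_eq dom_form_N max_graph_def)
  then have "\<omega> \<notin> form_closure S m (form_N S m \<delta> k) (cochains_fin S) \<Longrightarrow> form_N S m \<delta> k \<omega> = None" for \<omega>
    by (auto simp only: domIff)
  then show "form_D S m \<delta> k = form_N S m \<delta> k"
    unfolding form_D_def restrict_map_def by auto
qed

lemma polar_form_eq:
  assumes "\<omega> \<in> L2" "op_of k \<omega> \<in> L2" "\<phi> \<in> L2" "op_of k \<phi> \<in> L2"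
  shows "polar_form (form_N S m \<delta> k) \<omega> \<phi> = inner (embed (op_of k \<omega>)) (embed (op_of k \<phi>))"
proof -
  have "form_N S m \<delta> k (\<lambda>\<tau>. \<omega> \<tau> + \<phi> \<tau>) = Some ((norm (embed (op_of k \<omega>) + embed (op_of k \<phi>)))\<^sup>2)"
    unfolding form_N_eq op_plus[OF assms(1,3)]
    using assms by (simp add: l2_plus embed_plus)
  moreover have "form_N S m \<delta> k (\<lambda>\<tau>. \<omega> \<tau> - \<phi> \<tau>) = Some ((norm (embed (op_of k \<omega>) - embed (op_of k \<phi>)))\<^sup>2)"
    unfolding form_N_eq op_diff[OF assms(1,3)]
    using assms by (simp add: l2_diff embed_diff)
  ultimately show ?thesis
    using dot_norm[of "embed (op_of k \<omega>)" "embed (op_of k \<phi>)"]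
      dot_norm_neg[of "embed (op_of k \<omega>)" "embed (op_of k \<phi>)"]
    by (simp add: polar_form_def)
qed

text \<open>Since the core graph is dense in \<open>max_graph k\<close>, the adjoint of
  \<open>max_graph k\<close> is \<open>max_graph (adj_kind k)\<close>. The representing identity
  says exactly that \<open>(op_of k \<omega>, \<eta>)\<close>, after embedding, belongs to this
  adjoint.\<close>

lemma represents_iff:
  assumes "form_D S m \<delta> k = form_N S m \<delta> k" "\<omega> \<in> L2" "op_of k \<omega> \<in> L2"
  shows "represents S m (form_N S m \<delta> k) \<omega> \<eta> \<longleftrightarrow> \<eta> \<in> L2 \<and> \<eta> = op_of (adj_kind k) (op_of k \<omega>)"
proof -
  have cl: "closure (graph_on core (core_op k)) = max_graph k"
  proof
    show "max_graph k \<subseteq> closure (graph_on core (core_op k))"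
      using assms(1) form_D_eq_form_N_iff by blast
    have "closed (max_graph k)"
      unfolding max_graph_eq_adjoint by (rule closed_adjoint_rel[OF closed_H])
    moreover have "graph_on core (core_op k) \<subseteq> max_graph k"
      by (auto simp: graph_on_core max_graph_def fin_l2 op_fin_l2)
    ultimately show "closure (graph_on core (core_op k)) \<subseteq> max_graph k"
      by (simp add: closure_minimal)
  qed
  have kk: "adj_kind (adj_kind k) = k" by (cases k) simp_all
  have "adjoint_rel H (max_graph k) = max_graph (adj_kind k)"
    using max_graph_eq_adjoint[of "adj_kind k"] adjoint_rel_closure[of H "graph_on core (core_op k)"]
    by (simp add: kk cl)
  then have "(embed (op_of k \<omega>), embed \<eta>) \<in> adjoint_rel H (max_graph k) \<longleftrightarrow>
      \<eta> = op_of (adj_kind k) (op_of k \<omega>)" if "\<eta> \<in> L2"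
    using max_graph_iff[OF assms(3) that] by simp
  moreover have "(\<forall>\<phi>\<in>dom (form_N S m \<delta> k). polar_form (form_N S m \<delta> k) \<omega> \<phi> = l2_inner S m \<eta> \<phi>) \<longleftrightarrow>
      (embed (op_of k \<omega>), embed \<eta>) \<in> adjoint_rel H (max_graph k)" if "\<eta> \<in> L2"
  proof -
    have "(\<forall>\<phi>\<in>dom (form_N S m \<delta> k). polar_form (form_N S m \<delta> k) \<omega> \<phi> = l2_inner S m \<eta> \<phi>) \<longleftrightarrow>
        (\<forall>\<phi>. \<phi> \<in> L2 \<and> op_of k \<phi> \<in> L2 \<longrightarrow>
          inner (embed \<eta>) (embed \<phi>) = inner (embed (op_of k \<omega>)) (embed (op_of k \<phi>)))"
      unfolding dom_form_N Ball_def mem_Collect_eq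
      using assms(2,3) that by (intro all_cong) (auto simp: polar_form_eq inner_embed)
    also have "\<dots> \<longleftrightarrow> (embed (op_of k \<omega>), embed \<eta>) \<in> adjoint_rel H (max_graph k)"
      unfolding adjoint_rel_def max_graph_def using embed_in_H assms(3) that by blast
    finally show ?thesis .
  qed
  ultimately show ?thesis by (auto simp: represents_def)
qed

section \<open>The Laplacians and their resolvent sets\<close>

lemma laplacian_eq:
  assumes "form_D S m \<delta> k = form_N S m \<delta> k"
  shows "laplacian_N S m \<delta> k \<omega> =
    (if \<omega> \<in> L2 \<and> op_of k \<omega> \<in> L2 \<and> op_of (adj_kind k) (op_of k \<omega>) \<in> L2
     then Some (op_of (adj_kind k) (op_of k \<omega>)) else None)"
proof (cases "\<omega> \<in> L2 \<and> op_of k \<omega> \<in> L2")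
  case True
  then show ?thesis
    using represents_iff[OF assms, of \<omega>]
    by (auto simp: laplacian_N_def form_operator_def form_N_eq dom_form_N intro!: the_equality)
next
  case False
  then have "\<omega> \<notin> dom (form_N S m \<delta> k)" by (simp add: dom_form_N)
  with False show ?thesis by (auto simp: laplacian_N_def form_operator_def)
qed

lemma max_graph_relcomp_iff:
  "(x, z) \<in> max_graph k O max_graph (adj_kind k) \<longleftrightarrow>
    (\<exists>\<omega>. \<omega> \<in> L2 \<and> op_of k \<omega> \<in> L2 \<and> op_of (adj_kind k) (op_of k \<omega>) \<in> L2 \<and>
      x = embed \<omega> \<and> z = embed (op_of (adj_kind k) (op_of k \<omega>)))"
proof
  assume "(x, z) \<in> max_graph k O max_graph (adj_kind k)"
  then obtain y where y: "(x, y) \<in> max_graph k" "(y, z) \<in> max_graph (adj_kind k)" by blast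
  obtain \<omega> where w: "\<omega> \<in> L2" "op_of k \<omega> \<in> L2" "x = embed \<omega>" "y = embed (op_of k \<omega>)"
    using max_graph_in[OF y(1)] .
  obtain \<eta> where e: "\<eta> \<in> L2" "op_of (adj_kind k) \<eta> \<in> L2" "y = embed \<eta>"
      "z = embed (op_of (adj_kind k) \<eta>)"
    using max_graph_in[OF y(2)] .
  have "\<eta> = op_of k \<omega>" using w e embed_inject by metis
  then show "\<exists>\<omega>. \<omega> \<in> L2 \<and> op_of k \<omega> \<in> L2 \<and> op_of (adj_kind k) (op_of k \<omega>) \<in> L2 \<and>
      x = embed \<omega> \<and> z = embed (op_of (adj_kind k) (op_of k \<omega>))"
    using w e by blast
qed (use max_graph_iff in blast)

text \<open>The isometry \<open>embed\<close> carries the Laplacian to the composed relation. The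
  norm estimate supplies injectivity of the shifted operator, so bijectivity becomes
  surjectivity.\<close>

lemma resolvent_set_eq:
  assumes "form_D S m \<delta> k = form_N S m \<delta> k"
  shows "resolvent_set S m (laplacian_N S m \<delta> k) =
    resolvent_rel H (max_graph k O max_graph (adj_kind k))"
proof -
  define A where "A = laplacian_N S m \<delta> k"
  define a where "a \<omega> = op_of (adj_kind k) (op_of k \<omega>)" for \<omega>
  define X where "X = {\<omega>. \<omega> \<in> L2 \<and> op_of k \<omega> \<in> L2 \<and> a \<omega> \<in> L2}"
  have A: "A \<omega> = (if \<omega> \<in> X then Some (a \<omega>) else None)" for \<omega>
    using laplacian_eq[OF assms, of \<omega>] by (auto simp: A_def X_def a_def)
  have dom: "dom A = X" by (auto simp: A split: if_splits)
  define sh where "sh \<mu> \<omega> = (\<lambda>\<tau>. a \<omega> \<tau> - \<mu> * \<omega> \<tau>)" for \<mu> \<omega>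
  have sh: "shifted A \<mu> \<omega> = sh \<mu> \<omega>" if "\<omega> \<in> X" for \<mu> \<omega>
    using that by (simp add: shifted_def sh_def A)
  have sh_in: "sh \<mu> \<omega> \<in> L2" and embed_sh: "embed (sh \<mu> \<omega>) = embed (a \<omega>) - \<mu> *\<^sub>R embed \<omega>"
    if "\<omega> \<in> X" for \<mu> \<omega>
    using that l2_add[of "a \<omega>" \<omega> "- \<mu>"] embed_add[of "a \<omega>" \<omega> "- \<mu>"]
    by (auto simp: X_def sh_def)
  have L: "(x, z) \<in> max_graph k O max_graph (adj_kind k) \<longleftrightarrow>
      (\<exists>\<omega>\<in>X. x = embed \<omega> \<and> z = embed (a \<omega>))" for x z
    unfolding max_graph_relcomp_iff X_def a_def by blast
  have bound: "(\<forall>\<omega>\<in>X. l2_norm S m \<omega> \<le> C * l2_norm S m (sh \<mu> \<omega>)) \<longleftrightarrow>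
      (\<forall>(x, y)\<in>max_graph k O max_graph (adj_kind k). norm x \<le> C * norm (y - \<mu> *\<^sub>R x))" for C \<mu>
  proof -
    have "(\<forall>(x, y)\<in>max_graph k O max_graph (adj_kind k). norm x \<le> C * norm (y - \<mu> *\<^sub>R x)) \<longleftrightarrow>
        (\<forall>\<omega>\<in>X. norm (embed \<omega>) \<le> C * norm (embed (a \<omega>) - \<mu> *\<^sub>R embed \<omega>))"
      unfolding Ball_def split_paired_All case_prod_conv L by blast
    also have "\<dots> \<longleftrightarrow> (\<forall>\<omega>\<in>X. l2_norm S m \<omega> \<le> C * l2_norm S m (sh \<mu> \<omega>))"
      by (intro ball_cong refl) (use sh_in embed_sh in \<open>auto simp: l2_norm_embed X_def\<close>)
    finally show ?thesis by simp
  qed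
  have surj: "sh \<mu> ` X = L2 \<longleftrightarrow>
      (\<forall>f\<in>H. \<exists>x. (x, f + \<mu> *\<^sub>R x) \<in> max_graph k O max_graph (adj_kind k))" for \<mu>
  proof
    assume s: "sh \<mu> ` X = L2"
    show "\<forall>f\<in>H. \<exists>x. (x, f + \<mu> *\<^sub>R x) \<in> max_graph k O max_graph (adj_kind k)"
    proof
      fix f assume f: "f \<in> H"
      then obtain \<omega> where w: "\<omega> \<in> X" "unembed f = sh \<mu> \<omega>" using s unembed_in_l2 by blast
      then have "f = embed (a \<omega>) - \<mu> *\<^sub>R embed \<omega>" using embed_sh embed_unembed[OF f] by metis
      then have "f + \<mu> *\<^sub>R embed \<omega> = embed (a \<omega>)" by simp
      then show "\<exists>x. (x, f + \<mu> *\<^sub>R x) \<in> max_graph k O max_graph (adj_kind k)"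
        using L w(1) by metis
    qed
  next
    assume s: "\<forall>f\<in>H. \<exists>x. (x, f + \<mu> *\<^sub>R x) \<in> max_graph k O max_graph (adj_kind k)"
    show "sh \<mu> ` X = L2"
    proof
      show "sh \<mu> ` X \<subseteq> L2" using sh_in by blast
      show "L2 \<subseteq> sh \<mu> ` X"
      proof
        fix \<eta> assume eta: "\<eta> \<in> L2"
        obtain \<omega> where w: "\<omega> \<in> X" "embed \<eta> + \<mu> *\<^sub>R embed \<omega> = embed (a \<omega>)"
          using s embed_in_H[OF eta] L by metis
        then have "embed (sh \<mu> \<omega>) = embed \<eta>"
          unfolding embed_sh[OF w(1)] w(2)[symmetric] by simp
        then have "sh \<mu> \<omega> = \<eta>" using embed_inject sh_in[OF w(1)] eta by blast
        then show "\<eta> \<in> sh \<mu> ` X" using w(1) by blast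
      qed
    qed
  qed
  have inj: "inj_on (sh \<mu>) X"
    if C: "\<forall>\<omega>\<in>X. l2_norm S m \<omega> \<le> C * l2_norm S m (sh \<mu> \<omega>)" for C \<mu>
  proof (rule inj_onI)
    fix \<omega> \<eta> assume w: "\<omega> \<in> X" "\<eta> \<in> X" "sh \<mu> \<omega> = sh \<mu> \<eta>"
    have a: "a (\<lambda>\<tau>. \<omega> \<tau> - \<eta> \<tau>) = (\<lambda>\<tau>. a \<omega> \<tau> - a \<eta> \<tau>)"
      using w by (simp add: a_def X_def op_diff)
    have d: "(\<lambda>\<tau>. \<omega> \<tau> - \<eta> \<tau>) \<in> X"
      using w a by (simp add: X_def l2_diff op_diff)
    have "sh \<mu> (\<lambda>\<tau>. \<omega> \<tau> - \<eta> \<tau>) = (\<lambda>_. 0)"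
      using fun_cong[OF w(3)] by (simp add: sh_def a algebra_simps fun_eq_iff)
    then have "l2_norm S m (\<lambda>\<tau>. \<omega> \<tau> - \<eta> \<tau>) \<le> C * l2_norm S m (\<lambda>_. 0)"
      using bspec[OF C d] by simp
    then have "l2_norm S m (\<lambda>\<tau>. \<omega> \<tau> - \<eta> \<tau>) \<le> 0"
      by (simp add: l2_norm_def nsq_def)
    then have "embed (\<lambda>\<tau>. \<omega> \<tau> - \<eta> \<tau>) = 0" using d by (simp add: l2_norm_embed X_def)
    then have "embed \<omega> = embed \<eta>" using w by (simp add: embed_diff X_def)
    then show "\<omega> = \<eta>" using embed_inject w by (simp add: X_def)
  qed
  have bij: "bij_betw (shifted A \<mu>) X L2 \<longleftrightarrow> bij_betw (sh \<mu>) X L2" for \<mu>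
    by (rule bij_betw_cong) (rule sh)
  have "\<mu> \<in> resolvent_set S m A \<longleftrightarrow>
      \<mu> \<in> resolvent_rel H (max_graph k O max_graph (adj_kind k))" for \<mu>
  proof -
    have "\<mu> \<in> resolvent_set S m A \<longleftrightarrow>
        bij_betw (sh \<mu>) X L2 \<and> (\<exists>C. \<forall>\<omega>\<in>X. l2_norm S m \<omega> \<le> C * l2_norm S m (sh \<mu> \<omega>))"
      unfolding resolvent_set_def mem_Collect_eq dom bij using sh by simp
    also have "\<dots> \<longleftrightarrow>
        sh \<mu> ` X = L2 \<and> (\<exists>C. \<forall>\<omega>\<in>X. l2_norm S m \<omega> \<le> C * l2_norm S m (sh \<mu> \<omega>))"
      unfolding bij_betw_def using inj by blast
    also have "\<dots> \<longleftrightarrow> \<mu> \<in> resolvent_rel H (max_graph k O max_graph (adj_kind k))"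
      unfolding surj bound resolvent_rel_def by simp
    finally show ?thesis .
  qed
  then show ?thesis unfolding A_def by blast
qed

text \<open>The hypothesis is essential self-adjointness of the core Dirac operator. The closure
  results then give equality of the forms for \<open>Up\<close> and \<open>Down\<close>, and the
  three Laplacians become \<open>ED\<close>, \<open>DE\<close> and the Dirac square of one Hilbert
  complex.\<close>

lemma laplacians_agree_and_spectra:
  assumes "form_D S m \<delta> Hodge = form_N S m \<delta> Hodge"
  shows "laplacian_D S m \<delta> k = laplacian_N S m \<delta> k"
    and "op_spectrum S m (laplacian_D S m \<delta> Up) - {0} = op_spectrum S m (laplacian_D S m \<delta> Hodge) - {0}"
    and "op_spectrum S m (laplacian_D S m \<delta> Down) - {0} = op_spectrum S m (laplacian_D S m \<delta> Hodge) - {0}"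
proof -
  have T: "cc.max_T \<subseteq> closure cc.core_T"
    using assms form_D_eq_form_N_iff max_graph_max(3) graph_on_Hodge by simp
  have forms: "form_D S m \<delta> k = form_N S m \<delta> k" for k
    using cc.closure_core_d[OF T] cc.closure_core_e[OF T] assms
    by (cases k) (simp_all add: form_D_eq_form_N_iff max_graph_max)
  then show lap: "laplacian_D S m \<delta> k = laplacian_N S m \<delta> k" for k
    by (simp add: laplacian_D_def laplacian_N_def)
  interpret hilbert_complex H cc.max_d cc.max_e
    by (rule cc.hilbert_complex_max[OF T])
  have res: "resolvent_set S m (laplacian_D S m \<delta> Up) = resolvent_rel H (cc.max_d O cc.max_e)"
    "resolvent_set S m (laplacian_D S m \<delta> Down) = resolvent_rel H (cc.max_e O cc.max_d)"
    "resolvent_set S m (laplacian_D S m \<delta> Hodge) = resolvent_rel H (dirac O dirac)"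
    using resolvent_set_eq[OF forms] cc.dirac_max[OF T] by (simp_all add: lap max_graph_max)
  show "op_spectrum S m (laplacian_D S m \<delta> Up) - {0} = op_spectrum S m (laplacian_D S m \<delta> Hodge) - {0}"
    "op_spectrum S m (laplacian_D S m \<delta> Down) - {0} = op_spectrum S m (laplacian_D S m \<delta> Hodge) - {0}"
    unfolding op_spectrum_def res using resolvent_sets_agree by auto
qed

end

theorem theorem5p3:
  fixes V :: "'v set" and K S :: "'v set set" and m :: "'v set \<Rightarrow> real"
    and \<delta> :: "'v cochain \<Rightarrow> 'v cochain"
  assumes "abstract_simplicial_complex V K"
    and "simplex_weight K m"
    and "S = weighted_complex K m"
    and "locally_summable S m"
    and "coboundary_operator S \<delta>"
    and "form_D S m \<delta> Hodge = form_N S m \<delta> Hodge"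
  shows "(\<forall>k. laplacian_D S m \<delta> k = laplacian_N S m \<delta> k) \<and>
    op_spectrum S m (laplacian_D S m \<delta> Up) - {0} = op_spectrum S m (laplacian_D S m \<delta> Hodge) - {0} \<and>
    op_spectrum S m (laplacian_D S m \<delta> Hodge) - {0} = op_spectrum S m (laplacian_D S m \<delta> Down) - {0}"
proof -
  have "S \<subseteq> K" using assms(3) by (auto simp: weighted_complex_def split: if_splits)
  then interpret weighted_coboundary S m \<delta>
    using assms(1,2,4,5)
    by unfold_locales (auto simp: abstract_simplicial_complex_def simplex_weight_def)
  show ?thesis using laplacians_agree_and_spectra[OF assms(6)] by blast
qed

end
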